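(* Let $n$ and $\ell$ be integers with $n\ge \ell+1\ge 31$, and let $P_\ell$ be the path on $\ell$ vertices. Then $\operatorname{rwsat}(n,P_\ell)=\ell+1$.
   Context: All graphs are finite and simple; $\bar F$ is the complement of $F$. Colors are taken from an infinite set. An edge-colored graph is rainbow if all its edges receive distinct colors. For a fixed graph $H$, an edge-colored graph $F$ is weakly $H$-rainbow saturated if there is an ordering $e_1,\dots,e_m$ of $E(\bar F)$, $m=|E(\bar F)|$, such that for every injective coloring $c$ of $E(\bar F)$ (distinct edges of $\bar F$ get distinct colors, but these may coincide with colors used on $E(F)$) and every $1\le i\le m$, the edge-colored graph $F+\{e_1,\dots,e_i\}$ contains a rainbow copy of $H$ containing $e_i$. The weak rainbow saturation number $\operatorname{rwsat}(n,H)$ is the minimum number of edges of a weakly $H$-rainbow saturated (edge-colored) graph on $n$ vertices. *)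

theory Defs
  imports Main "HOL-Library.FuncSet"
begin

record 'a graph =
  verts :: "'a set"
  edges :: "'a set set"

definition simple_graph :: "'a graph \<Rightarrow> bool" where
  "simple_graph G \<longleftrightarrow> finite (verts G) \<and> (\<forall>e\<in>edges G. e \<subseteq> verts G \<and> card e = 2)"

definition complement :: "'a graph \<Rightarrow> 'a graph" where
  "complement G =
     \<lparr>verts = verts G, edges = {e. e \<subseteq> verts G \<and> card e = 2} - edges G\<rparr>"

definition add_edges :: "'a graph \<Rightarrow> 'a set set \<Rightarrow> 'a graph" where
  "add_edges G S = \<lparr>verts = verts G, edges = edges G \<union> S\<rparr>"

definition subgraph :: "'a graph \<Rightarrow> 'a graph \<Rightarrow> bool" where
  "subgraph K G \<longleftrightarrow> simple_graph K \<and> verts K \<subseteq> verts G \<and> edges K \<subseteq> edges G"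

definition isomorphic :: "'a graph \<Rightarrow> 'b graph \<Rightarrow> bool" where
  "isomorphic G K \<longleftrightarrow>
     (\<exists>f. bij_betw f (verts G) (verts K) \<and> edges K = (\<lambda>e. f ` e) ` edges G)"

definition copy_of :: "'b graph \<Rightarrow> 'a graph \<Rightarrow> 'a graph \<Rightarrow> bool" where
  "copy_of H G K \<longleftrightarrow> subgraph K G \<and> isomorphic H K"

definition rainbow :: "('a set \<Rightarrow> 'c) \<Rightarrow> 'a graph \<Rightarrow> bool" where
  "rainbow k G \<longleftrightarrow> inj_on k (edges G)"

text \<open>
  An edge-colored graph is a simple graph \<open>F\<close> together with a map \<open>k\<close> whose values on the
  edges of \<open>F\<close> lie in the set \<open>C\<close> of colors; it need not be a proper coloring, and values of
  \<open>k\<close> off the edges of \<open>F\<close> are irrelevant.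
\<close>

definition edge_colored_graph :: "'c set \<Rightarrow> 'a graph \<Rightarrow> ('a set \<Rightarrow> 'c) \<Rightarrow> bool" where
  "edge_colored_graph C F k \<longleftrightarrow> simple_graph F \<and> k \<in> edges F \<rightarrow> C"

definition join_coloring ::
  "'a graph \<Rightarrow> ('a set \<Rightarrow> 'c) \<Rightarrow> ('a set \<Rightarrow> 'c) \<Rightarrow> 'a set \<Rightarrow> 'c" where
  "join_coloring F k c = (\<lambda>e. if e \<in> edges F then k e else c e)"

text \<open>
  The ordering \<open>es\<close> is chosen before the coloring \<open>c\<close>; the copy \<open>K\<close> may depend on \<open>c\<close>.
  List positions start at 0, so \<open>take (Suc i) es\<close> ends with the edge \<open>es ! i\<close>.
\<close>

definition weakly_rainbow_saturated ::
  "'c set \<Rightarrow> 'b graph \<Rightarrow> 'a graph \<Rightarrow> ('a set \<Rightarrow> 'c) \<Rightarrow> bool" where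
  "weakly_rainbow_saturated C H F k \<longleftrightarrow>
     (\<exists>es. distinct es \<and> set es = edges (complement F) \<and>
        (\<forall>c. c \<in> edges (complement F) \<rightarrow> C \<and> inj_on c (edges (complement F)) \<longrightarrow>
          (\<forall>i<length es. \<exists>K.
             copy_of H (add_edges F (set (take (Suc i) es))) K \<and>
             rainbow (join_coloring F k c) K \<and> es ! i \<in> edges K)))"

text \<open>
  The minimum is over a nonempty set of numbers: complete graphs are vacuously weakly
  rainbow saturated.
\<close>

definition rwsat :: "'c set \<Rightarrow> nat \<Rightarrow> 'b graph \<Rightarrow> nat" where
  "rwsat C n H =
     (LEAST m. \<exists>(F :: nat graph) k.
        verts F = {..<n} \<and> edge_colored_graph C F k \<and>
        weakly_rainbow_saturated C H F k \<and> card (edges F) = m)"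

definition path_graph :: "nat \<Rightarrow> nat graph" where
  "path_graph l = \<lparr>verts = {..<l}, edges = {{i, Suc i} | i. Suc i < l}\<rparr>"

end

theory Submission
  imports Defs
begin

text \<open>
  Lower bound. Suppose \<open>F\<close> has at most \<open>l\<close> edges. The adversary gives the first non-edges
  \<open>e\<^sub>0, \<dots>, e\<^sub>t\<close> the colors of edges \<open>f\<^sub>0, \<dots>, f\<^sub>t\<close> of \<open>F\<close> that are far apart and
  far from every vertex of degree other than 0 and 2. A path on \<open>l\<close> vertices misses at most
  \<open>t + 2\<close> edges of \<open>F + {e\<^sub>0, \<dots>, e\<^sub>t}\<close>, and counting vertices of degree 1 shows that these
  are \<open>e\<^sub>0, \<dots>, e\<^bsub>t-1\<^esub>, f\<^sub>t\<close> and at most one more. Hence \<open>e\<^sub>t\<close> turns \<open>F\<close>, up to deleting one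
  edge, into a graph with all degrees 0 or 2. A parity argument shows that at most three
  non-edges do this, so the process fails within four steps.

  Upper bound. Take \<open>F\<close> to be a rainbow cycle on \<open>m = l + 1\<close> vertices. Each chord skipping one
  vertex closes a cycle on \<open>l\<close> vertices, from which the edge with the conflicting color can be
  deleted. The added edges always form a rainbow graph by themselves, and they soon contain a
  Hamiltonian cycle on the \<open>m\<close> vertices: the chords alone if \<open>m\<close> is odd, and after joining the
  two classes of chords if \<open>m\<close> is even. From then on every edge lies on a path of added edges.
\<close>

subsection \<open>Lower bound\<close>

definition deg :: "'a set set \<Rightarrow> 'a \<Rightarrow> nat" where
  "deg E v = card {e \<in> E. v \<in> e}"

definition two_uniform :: "'a set set \<Rightarrow> bool" where
  "two_uniform E \<longleftrightarrow> finite E \<and> (\<forall>e\<in>E. card e = 2)"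

lemma deg_insert:
  assumes "finite E" "e \<notin> E"
  shows "deg (insert e E) v = deg E v + (if v \<in> e then 1 else 0)"
proof (cases "v \<in> e")
  case True
  then have "{h \<in> insert e E. v \<in> h} = insert e {h \<in> E. v \<in> h}" by auto
  then show ?thesis using assms True by (simp add: deg_def)
next
  case False
  then have "{h \<in> insert e E. v \<in> h} = {h \<in> E. v \<in> h}" by auto
  then show ?thesis using False by (simp add: deg_def)
qed

lemma deg_remove:
  assumes "finite E" "e \<in> E"
  shows "deg E v = deg (E - {e}) v + (if v \<in> e then 1 else 0)"
  using deg_insert[of "E - {e}" e v] assms by (simp add: insert_absorb)

lemma deg_mono: "finite E \<Longrightarrow> D \<subseteq> E \<Longrightarrow> deg D v \<le> deg E v"
  unfolding deg_def by (rule card_mono) auto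

lemma card_meeting_le:
  assumes "finite E" "finite V"
  shows "card {h \<in> E. h \<inter> V \<noteq> {}} \<le> (\<Sum>v\<in>V. deg E v)"
proof -
  have "{h \<in> E. h \<inter> V \<noteq> {}} = (\<Union>v\<in>V. {h \<in> E. v \<in> h})" by auto
  then show ?thesis unfolding deg_def using card_UN_le[OF assms(2)] by metis
qed

lemma card_meeting_edge_le:
  assumes "finite E" "card e = 2" "\<And>v. v \<in> e \<Longrightarrow> deg E v \<le> d"
  shows "card {h \<in> E. h \<inter> e \<noteq> {}} \<le> 2 * d"
proof -
  have "finite e" using assms(2) card.infinite by fastforce
  then have "card {h \<in> E. h \<inter> e \<noteq> {}} \<le> (\<Sum>v\<in>e. deg E v)"
    using card_meeting_le assms(1) by blast
  also have "\<dots> \<le> (\<Sum>v\<in>e. d)" using assms(3) by (rule sum_mono)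
  finally show ?thesis using assms(2) by simp
qed

lemma deg_two_edges:
  assumes "finite E" "deg E v = 2" "h \<in> E" "v \<in> h"
  obtains k where "{e \<in> E. v \<in> e} = {h, k}" "k \<noteq> h" "k \<in> E" "v \<in> k"
proof -
  have "card {e \<in> E. v \<in> e} = 2" using assms(2) by (simp add: deg_def)
  then obtain a b where ab: "{e \<in> E. v \<in> e} = {a, b}" "a \<noteq> b" by (meson card_2_iff)
  have "h \<in> {a, b}" using ab assms(3,4) by blast
  then have "h = a \<or> h = b" by blast
  then show ?thesis
  proof
    assume "h = a"
    then show ?thesis using ab by (intro that[of b]) blast+
  next
    assume "h = b"
    then show ?thesis using ab by (intro that[of a]) blast+
  qed
qed

lemma card_two_other:
  assumes "card e = 2" "v \<in> e"
  obtains w where "e = {v, w}" "w \<noteq> v"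
  using assms by (metis card_2_iff insertE insert_commute singletonD)

section \<open>Non-edges that close a graph into cycles\<close>

text \<open>Only the degrees of a path with ends \<open>x\<close> and \<open>y\<close> are kept, not
  its connectivity: the lower bound argues by degrees and edge counts alone. Degree 0 is for
  vertices off the path.\<close>

definition path_degrees :: "'a set set \<Rightarrow> 'a \<Rightarrow> 'a \<Rightarrow> bool" where
  "path_degrees K x y \<longleftrightarrow>
     x \<noteq> y \<and> deg K x = 1 \<and> deg K y = 1 \<and> (\<forall>v. v \<notin> {x, y} \<longrightarrow> deg K v \<in> {0, 2})"

text \<open>In a finite graph, degrees 0 and 2 throughout mean a disjoint union of cycles and
  isolated vertices. The set collects the non-edges that the adversary may be unable to
  block.\<close>

definition closers :: "'a set set \<Rightarrow> 'a set set" where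
  "closers F = {e. card e = 2 \<and> e \<notin> F \<and>
     (\<exists>G\<subseteq>F. card G \<le> 1 \<and> (\<forall>v. deg (insert e F - G) v \<in> {0, 2}))}"

text \<open>For edges of \<open>F\<close>, taking \<open>h\<close> to be \<open>e\<close> itself
  shows that \<open>e\<close> and \<open>f\<close> are also disjoint, so they are at distance at
  least two.\<close>

definition separated :: "'a set set \<Rightarrow> 'a set \<Rightarrow> 'a set \<Rightarrow> bool" where
  "separated F e f \<longleftrightarrow> (\<forall>h\<in>F. h \<inter> e = {} \<or> h \<inter> f = {})"

lemma separated_disjoint: "separated F e f \<Longrightarrow> e \<in> F \<Longrightarrow> e \<noteq> {} \<Longrightarrow> e \<inter> f = {}"
  unfolding separated_def by blast

lemma separated_sym: "separated F e f \<Longrightarrow> separated F f e"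
  unfolding separated_def by blast

text \<open>Equal colors are reflected in \<open>fK\<close>: \<open>K\<close> misses
  \<open>f t\<close> and one edge of each pair \<open>e j\<close>, \<open>f j\<close> with
  \<open>j < t\<close>. Counting leaves at most one further missed edge, and a missed
  \<open>f j\<close> with \<open>j < t\<close> would create too many vertices of degree 1. So
  \<open>K\<close> is \<open>F\<close> with \<open>e t\<close>, without \<open>f t\<close> and at
  most one edge \<open>g\<close> of \<open>F\<close>. Putting back \<open>f t\<close>, and also
  \<open>g\<close> if it is adjacent to \<open>f t\<close>, leaves only degrees 0 and 2.\<close>

lemma closers_step:
  fixes e f :: "nat \<Rightarrow> 'a set"
  assumes F: "two_uniform F" "card F \<le> l"
    and e: "\<And>j. j \<le> t \<Longrightarrow> e j \<notin> F \<and> card (e j) = 2" "inj_on e {..t}"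
    and f: "\<And>j. j \<le> t \<Longrightarrow> f j \<in> F" "inj_on f {..t}"
    and K: "K \<subseteq> F \<union> e ` {..t}" "e t \<in> K" "card K = l - 1" "1 \<le> l" "path_degrees K x y"
    and fK: "f t \<notin> K" "\<And>j. j < t \<Longrightarrow> \<not> (e j \<in> K \<and> f j \<in> K)"
    and deg_f: "\<And>j v. j \<le> t \<Longrightarrow> v \<in> f j \<Longrightarrow> deg F v = 2 \<and> (\<forall>i\<le>t. v \<notin> e i)"
    and sep: "\<And>j. j < t \<Longrightarrow> separated F (f j) (f t)"
    and disj: "\<And>i j. i \<le> t \<Longrightarrow> j \<le> t \<Longrightarrow> i \<noteq> j \<Longrightarrow> f i \<inter> f j = {}"
    and strong: "\<And>h v. h \<in> F \<Longrightarrow> h \<inter> f t \<noteq> {} \<Longrightarrow> v \<in> h \<Longrightarrow> deg F v = 2 \<and> v \<notin> e t"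
  shows "e t \<in> closers F"
proof -
  have finF: "finite F" using F by (auto simp: two_uniform_def)
  have c2: "\<And>h. h \<in> F \<Longrightarrow> card h = 2" using F by (auto simp: two_uniform_def)
  define D where "D = (F \<union> e ` {..t}) - K"
  have "card (F \<union> e ` {..t}) \<le> card F + card (e ` {..t})" by (rule card_Un_le)
  also have "card (e ` {..t}) = t + 1" using e(2) by (simp add: card_image)
  finally have "card (F \<union> e ` {..t}) \<le> l + t + 1" using F(2) by simp
  moreover have "finite K" using K(1) finF finite_subset by blast
  \<comment> \<open>At most \<open>l\<close> old and \<open>t + 1\<close> new edges, less the
    \<open>l - 1\<close> edges of \<open>K\<close>; the subtraction is exact because
    \<open>1 \<le> l\<close>.\<close>
  ultimately have cD: "card D \<le> t + 2"
    unfolding D_def using K(1,3,4) by (simp add: card_Diff_subset)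
  have finD: "finite D" unfolding D_def using finF by simp
  \<comment> \<open>One missed edge from each pair \<open>e j\<close>, \<open>f j\<close>. Together
    with \<open>f t\<close> these are \<open>t + 1\<close> different missed edges, so there is room
    for only one more.\<close>
  define w where "w j = (if f j \<in> K then e j else f j)" for j
  define W where "W = insert (f t) (w ` {..<t})"
  have winj: "inj_on w {..<t}"
  proof (rule inj_onI)
    fix i j assume ij: "i \<in> {..<t}" "j \<in> {..<t}" "w i = w j"
    then have "i \<le> t" "j \<le> t" by auto
    then show "i = j" using ij e(1)[of i] e(1)[of j] f(1)[of i] f(1)[of j]
        inj_onD[OF e(2), of i j] inj_onD[OF f(2), of i j]
      by (auto simp: w_def split: if_splits)
  qed
  have "f t \<notin> w ` {..<t}"
  proof
    assume "f t \<in> w ` {..<t}"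
    then obtain j where j: "j < t" "f t = w j" by blast
    then show False using e(1)[of j] f(1)[of t] inj_onD[OF f(2), of t j]
      by (auto simp: w_def split: if_splits)
  qed
  then have cW: "card W = t + 1" unfolding W_def using winj by (simp add: card_image)
  have WD: "W \<subseteq> D"
    unfolding W_def D_def w_def using f(1) fK by auto
  define G where "G = D - W"
  have cG: "card G \<le> 1" unfolding G_def using cD cW WD finD
    by (simp add: card_Diff_subset finite_subset)
  have finG: "finite G" using finD by (simp add: G_def)
  have G1: "g = g'" if "g \<in> G" "g' \<in> G" for g g'
    using card_le_Suc0_iff_eq[OF finG] cG that by auto
  \<comment> \<open>If \<open>f j\<close> and \<open>f t\<close> were both missed, each of their
    four ends would be a path end or lie on the edge of \<open>G\<close>. That edge contains at most
    one of the four, by \<open>same\<close> and \<open>no2\<close>, and the path has only two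
    ends.\<close>
  have allK: "f j \<in> K" if j: "j < t" for j
  proof (rule ccontr)
    assume fj: "f j \<notin> K"
    \<comment> \<open>The other edge of \<open>F\<close> at \<open>v\<close> is either in
      \<open>K\<close>, which gives \<open>v\<close> degree 1 there, or missed. In the second case
      it is the edge of \<open>G\<close>, since disjointness of the \<open>f m\<close> keeps it out
      of \<open>W\<close>.\<close>
    have loose: "v \<in> {x, y} \<or> (\<exists>g\<in>G. v \<in> g \<and> g \<in> F \<and> g \<noteq> f i)"
      if i: "i \<in> {j, t}" and v: "v \<in> f i" for v i
    proof -
      have it: "i \<le> t" and fi: "f i \<notin> K" using i j fj fK(1) by auto
      have d: "deg F v = 2" "\<And>i. i \<le> t \<Longrightarrow> v \<notin> e i" using deg_f[OF it v] by auto
      obtain h where h: "{k \<in> F. v \<in> k} = {f i, h}" "h \<noteq> f i" "h \<in> F" "v \<in> h"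
        using deg_two_edges[OF finF d(1) f(1)[OF it] v] by metis
      show ?thesis
      proof (cases "h \<in> K")
        case True
        have "k = h" if k: "k \<in> K" "v \<in> k" for k
        proof -
          have "k \<in> F" using K(1) k d(2) by fastforce
          then have "k \<in> {f i, h}" using h(1) k by blast
          then show ?thesis using fi k by blast
        qed
        then have "{k \<in> K. v \<in> k} = {h}" using True h(4) by blast
        then have "deg K v = 1" by (simp add: deg_def)
        then show ?thesis using K(5) unfolding path_degrees_def by force
      next
        case False
        then have "h \<in> D" using h by (simp add: D_def)
        moreover have nf: "h \<noteq> f m" if "m \<le> t" for m
          using disj[OF it that] h(2,4) v by (cases "m = i") auto
        moreover have "h \<noteq> w m" if "m < t" for m
          using nf[of m] e(1)[of m] h(3) that unfolding w_def by (cases "f m \<in> K") auto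
        ultimately have "h \<in> G" unfolding G_def W_def by blast
        then show ?thesis using h by blast
      qed
    qed
    obtain a b where ab: "f j = {a, b}" "a \<noteq> b" using c2[OF f(1)[of j]] j by (auto simp: card_2_iff)
    obtain p q where pq: "f t = {p, q}" "p \<noteq> q" using c2[OF f(1)[of t]] by (auto simp: card_2_iff)
    have dj: "{a, b} \<inter> {p, q} = {}" using disj[of j t] j ab pq by auto
    have no2: False if "g \<in> F" "u \<in> g" "v \<in> g" "u \<in> f j" "v \<in> f t" for g u v
      using sep[OF j] that unfolding separated_def by blast
    have same: "g = {u, v}" if "g \<in> F" "u \<in> g" "v \<in> g" "u \<noteq> v" for g u v
      using card_two_other[OF c2[OF that(1)] that(2)] that by (metis insertE singletonD)
    note La = loose[of j a] and Lb = loose[of j b] and Lp = loose[of t p] and Lq = loose[of t q]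
    have "a \<in> {x,y} \<or> b \<in> {x,y}"
    proof (rule ccontr)
      assume "\<not> ?thesis"
      then obtain g g' where "g \<in> G" "a \<in> g" "g \<in> F" "g \<noteq> f j" "g' \<in> G" "b \<in> g'"
        using La Lb ab by blast
      then show False using G1[of g g'] same[of g a b] ab by auto
    qed
    moreover have "p \<in> {x,y} \<or> q \<in> {x,y}"
    proof (rule ccontr)
      assume "\<not> ?thesis"
      then obtain g g' where "g \<in> G" "p \<in> g" "g \<in> F" "g \<noteq> f t" "g' \<in> G" "q \<in> g'"
        using Lp Lq pq by blast
      then show False using G1[of g g'] same[of g p q] pq by auto
    qed
    moreover have "u \<in> {x,y} \<or> v \<in> {x,y}" if uv: "u \<in> {a,b}" "v \<in> {p,q}" for u v
    proof (rule ccontr)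
      assume "\<not> ?thesis"
      then obtain g g' where "g \<in> G" "u \<in> g" "g \<in> F" "g' \<in> G" "v \<in> g'"
        using loose[of j u] loose[of t v] uv ab pq by blast
      then show False using G1[of g g'] no2[of g u v] ab pq uv by auto
    qed
    ultimately show False using dj ab(2) pq(2)
      by (metis Int_iff emptyE insert_iff)
  qed
  have Weq: "W = insert (f t) (e ` {..<t})" unfolding W_def w_def using allK by (auto simp: image_def)
  have GF: "G \<subseteq> F"
  proof
    fix g assume g: "g \<in> G"
    show "g \<in> F"
    proof (rule ccontr)
      assume "g \<notin> F"
      then obtain i where i: "i \<le> t" "g = e i" using g by (auto simp: G_def D_def)
      have "g \<notin> W" "g \<notin> K" using g by (auto simp: G_def D_def)
      then show False using i Weq K(2) by (cases "i = t") auto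
    qed
  qed
  define M where "M = insert (e t) F"
  have et: "e t \<notin> e ` {..<t}"
    using inj_on_image_mem_iff[OF e(2), of t "{..<t}"] by (simp add: subset_iff)
  have eF: "\<And>i. i \<le> t \<Longrightarrow> e i \<notin> F" using e(1) by auto
  have Keq: "K = M - {f t} - G"
  proof -
    have "K = (F \<union> e ` {..t}) - D" using K(1) by (auto simp: D_def)
    also have "D = insert (f t) (e ` {..<t}) \<union> G" using WD Weq by (auto simp: G_def)
    also have "(F \<union> e ` {..t}) - (insert (f t) (e ` {..<t}) \<union> G) = M - {f t} - G"
    proof -
      have "{..t} = insert t {..<t}" by auto
      moreover have "e ` {..<t} \<inter> F = {}" using eF by auto
      ultimately show ?thesis using et by (auto simp: M_def)
    qed
    finally show ?thesis .
  qed
  have finM: "finite M" by (simp add: M_def finF)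
  have ftF: "f t \<in> F" using f(1) by simp
  have ftM: "f t \<in> M" using ftF by (simp add: M_def)
  have degM: "deg M v = deg F v" if "v \<notin> e t" for v
    using deg_insert[OF finF, of "e t" v] eF[of t] that by (simp add: M_def)
  obtain a b where ab: "f t = {a, b}" "a \<noteq> b" using c2[OF ftF] by (auto simp: card_2_iff)
  have pd: "deg K v = 0 \<or> deg K v = 2 \<or> v = x \<or> v = y" "deg K x = 1" "deg K y = 1" "x \<noteq> y" for v
    using K(5) unfolding path_degrees_def by auto
  \<comment> \<open>If no edge of \<open>G\<close> touches \<open>f t\<close>, the ends of
    \<open>f t\<close> have degree 1 in \<open>K\<close>, so they are the path ends, and adding
    \<open>f t\<close> to \<open>K\<close> gives the required graph.\<close>
  show ?thesis
  proof (cases "\<exists>g\<in>G. g \<inter> f t \<noteq> {}")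
    case False
    have ft: "f t \<notin> G" using False ab by blast
    have MG: "M - G = insert (f t) K" using Keq ftM ft by auto
    have degMG: "deg (M - G) v = deg K v + (if v \<in> f t then 1 else 0)" for v
      using MG deg_insert[OF \<open>finite K\<close> fK(1)] by simp
    have "deg (M - G) v = 2" if "v \<in> f t" for v
    proof -
      have "{h \<in> M - G. v \<in> h} = {h \<in> M. v \<in> h}" using False that by auto
      then have "deg (M - G) v = deg M v" by (simp add: deg_def)
      then show ?thesis using strong[OF ftF _ that] degM ab by auto
    qed
    then have "deg K a = 1" "deg K b = 1" using degMG[of a] degMG[of b] ab by auto
    then have "{a, b} = {x, y}" using pd(1)[of a] pd(1)[of b] ab(2) by auto
    then have "deg (M - G) v \<in> {0, 2}" for v
      using pd(1)[of v] pd(2,3) degMG[of v] ab by auto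
    then show ?thesis unfolding closers_def using GF cG e(1)[of t] M_def by auto
  next
    case True
    then obtain g where g: "g \<in> G" "g \<inter> f t \<noteq> {}" by blast
    have Gg: "G = {g}" using G1 g by auto
    have gF: "g \<in> F" using g GF by blast
    have gft: "g \<noteq> f t" using g(1) by (auto simp: G_def W_def)
    \<comment> \<open>Now \<open>f t\<close> and \<open>g\<close> share the vertex
      \<open>b'\<close>, and their other ends \<open>a'\<close> and \<open>c\<close> are the path
      ends. Restoring both edges shows that \<open>F\<close> with \<open>e t\<close> needs no
      deletion.\<close>
    obtain b' where b': "b' \<in> g" "b' \<in> f t" using g by blast
    obtain c where c: "g = {b', c}" "c \<noteq> b'" using card_two_other[OF c2[OF gF] b'(1)] by metis
    obtain a' where a': "f t = {b', a'}" "a' \<noteq> b'" using card_two_other[OF c2[OF ftF] b'(2)] by metis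
    have ac: "a' \<noteq> c" using a' c gft by auto
    have M2: "deg M v = 2" if "v \<in> g \<union> f t" for v
    proof -
      have "deg F v = 2 \<and> v \<notin> e t"
        using that strong[OF ftF, of v] strong[OF gF g(2), of v] ab by blast
      then show ?thesis using degM by auto
    qed
    have Mdeg: "deg M v = deg K v + (if v \<in> f t then 1 else 0) + (if v \<in> g then 1 else 0)" for v
    proof -
      have "deg M v = deg (M - {f t}) v + (if v \<in> f t then 1 else 0)"
        by (rule deg_remove[OF finM ftM])
      moreover have "deg (M - {f t}) v = deg (M - {f t} - {g}) v + (if v \<in> g then 1 else 0)"
        by (rule deg_remove) (use finM gF gft M_def in auto)
      ultimately show ?thesis using Keq Gg by simp
    qed
    have "deg K a' = 1" using Mdeg[of a'] M2[of a'] a' c ac by auto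
    moreover have "deg K c = 1" using Mdeg[of c] M2[of c] a' c ac by auto
    ultimately have xy: "{a', c} = {x, y}" using pd(1)[of a'] pd(1)[of c] ac by auto
    have "deg M v \<in> {0, 2}" for v
    proof (cases "v \<in> g \<union> f t")
      case True then show ?thesis using M2 by simp
    next
      case False
      then have "v \<notin> {x, y}" using xy a' c by blast
      then show ?thesis using False Mdeg[of v] pd(1)[of v] by auto
    qed
    then have "\<forall>v. deg (insert (e t) F - {}) v \<in> {0, 2}" by (simp add: M_def)
    then show ?thesis unfolding closers_def using e(1)[of t]
      by (intro CollectI conjI exI[of _ "{}"]) auto
  qed
qed

section \<open>Separated edges far from irregular vertices\<close>

text \<open>An edge of \<open>X\<close> has an end in \<open>B\<close>. An edge outside
  \<open>X\<close> can meet it only at its other end, which then has degree 2 and lies on just one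
  further edge. So each edge of \<open>X\<close> accounts for itself and at most one edge
  more.\<close>

lemma card_meeting_met_le:
  assumes F: "two_uniform F"
    and B: "\<And>v. v \<notin> B \<Longrightarrow> deg F v \<in> {0, 2}"
    and X: "X = {h \<in> F. h \<inter> B \<noteq> {}}"
  shows "card {h \<in> F. \<exists>h'\<in>X. h \<inter> h' \<noteq> {}} \<le> 2 * card X"
proof -
  have finF: "finite F" and c2: "\<And>h. h \<in> F \<Longrightarrow> card h = 2" using F by (auto simp: two_uniform_def)
  have finX: "finite X" using X finF by simp
  have one: "card {k \<in> F - X. k \<inter> h \<noteq> {}} \<le> 1" if h: "h \<in> X" for h
  proof -
    have hF: "h \<in> F" using h X by simp
    obtain b where b: "b \<in> h" "b \<in> B" using h X by blast
    obtain v where v: "h = {b, v}" "v \<noteq> b" using card_two_other[OF c2[OF hF] b(1)] by metis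
    have meet: "v \<in> k \<and> v \<notin> B" if "k \<in> F - X" "k \<inter> h \<noteq> {}" for k
      using that b v X by blast
    show ?thesis
    proof (cases "{k \<in> F - X. k \<inter> h \<noteq> {}} = {}")
      case True then show ?thesis by (simp only: card.empty)
    next
      case False
      then obtain k0 where k0: "k0 \<in> F - X" "k0 \<inter> h \<noteq> {}" by blast
      then have "v \<notin> B" using meet by blast
      moreover have "deg F v \<noteq> 0" using v hF finF by (auto simp: deg_def)
      ultimately have "deg F v = 2" using B by force
      then obtain k where k: "{e \<in> F. v \<in> e} = {h, k}"
        using deg_two_edges[OF finF _ hF, of v] v by blast
      have "{k \<in> F - X. k \<inter> h \<noteq> {}} \<subseteq> {k}"
      proof
        fix k' assume "k' \<in> {k \<in> F - X. k \<inter> h \<noteq> {}}"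
        then have "k' \<in> {e \<in> F. v \<in> e}" "k' \<noteq> h" using meet h by blast+
        then show "k' \<in> {k}" using k by blast
      qed
      then show ?thesis using card_mono[of "{k}"] by fastforce
    qed
  qed
  have "{h \<in> F. \<exists>h'\<in>X. h \<inter> h' \<noteq> {}} \<subseteq> X \<union> (\<Union>h\<in>X. {k \<in> F - X. k \<inter> h \<noteq> {}})" by auto
  then have "card {h \<in> F. \<exists>h'\<in>X. h \<inter> h' \<noteq> {}} \<le> card (X \<union> (\<Union>h\<in>X. {k \<in> F - X. k \<inter> h \<noteq> {}}))"
    by (rule card_mono[rotated]) (use finX finF in auto)
  also have "\<dots> \<le> card X + card (\<Union>h\<in>X. {k \<in> F - X. k \<inter> h \<noteq> {}})" by (rule card_Un_le)
  also have "card (\<Union>h\<in>X. {k \<in> F - X. k \<inter> h \<noteq> {}}) \<le> (\<Sum>h\<in>X. card {k \<in> F - X. k \<inter> h \<noteq> {}})"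
    by (rule card_UN_le[OF finX])
  also have "\<dots> \<le> (\<Sum>h\<in>X. 1)" by (rule sum_mono) (rule one)
  finally show ?thesis by simp
qed

text \<open>Both ends of \<open>f\<close> have degree 2, so the edges in question are
  \<open>f\<close> and at most two successive edges in either direction. A walk that runs into
  \<open>B\<close> contributes nothing beyond that vertex.\<close>

lemma card_not_separated_le:
  assumes F: "two_uniform F"
    and B: "\<And>v. v \<notin> B \<Longrightarrow> deg F v \<in> {0, 2}"
    and X: "X = {h \<in> F. h \<inter> B \<noteq> {}}"
    and f: "f \<in> F - X"
  shows "card {h \<in> F - X. \<not> separated F f h} \<le> 5"
proof -
  have finF: "finite F" and c2: "\<And>h. h \<in> F \<Longrightarrow> card h = 2" using F by (auto simp: two_uniform_def)
  have nbr: "\<exists>k. {e \<in> F. v \<in> e} = {h, k} \<and> k \<in> F \<and> v \<in> k" if "v \<notin> B" "h \<in> F" "v \<in> h" for v h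
  proof -
    have "deg F v \<noteq> 0" using that finF by (auto simp: deg_def)
    then have "deg F v = 2" using B[OF that(1)] by simp
    then show ?thesis using deg_two_edges[OF finF _ that(2,3)] by metis
  qed
  have ext: "\<exists>k. {e \<in> F - X. e \<inter> h \<noteq> {}} \<subseteq> {f, h, k}"
    if h: "h \<in> F" "a \<in> h" and a: "{e \<in> F. a \<in> e} = {f, h}" for h a
  proof -
    obtain v where v: "h = {a, v}" "v \<noteq> a" using card_two_other[OF c2[OF h(1)] h(2)] by metis
    show ?thesis
    proof (cases "v \<in> B")
      case True
      then have "{e \<in> F - X. e \<inter> h \<noteq> {}} \<subseteq> {e \<in> F. a \<in> e}" using X v by blast
      then show ?thesis using a by blast
    next
      case False
      then obtain k where "{e \<in> F. v \<in> e} = {h, k}" using nbr[of v h] h v by blast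
      moreover have "{e \<in> F - X. e \<inter> h \<noteq> {}} \<subseteq> {e \<in> F. a \<in> e} \<union> {e \<in> F. v \<in> e}" using v by blast
      ultimately show ?thesis using a by auto
    qed
  qed
  have fF: "f \<in> F" using f by blast
  obtain a b where ab: "f = {a, b}" "a \<noteq> b" using c2[OF fF] by (auto simp: card_2_iff)
  have "a \<notin> B" "b \<notin> B" using f X ab by auto
  obtain h where h: "{e \<in> F. a \<in> e} = {f, h}" "h \<in> F" "a \<in> h"
    using nbr[OF \<open>a \<notin> B\<close> fF] ab by blast
  obtain h' where h': "{e \<in> F. b \<in> e} = {f, h'}" "h' \<in> F" "b \<in> h'"
    using nbr[OF \<open>b \<notin> B\<close> fF] ab by blast
  obtain k where k: "{e \<in> F - X. e \<inter> h \<noteq> {}} \<subseteq> {f, h, k}" using ext[OF h(2,3,1)] by blast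
  obtain k' where k': "{e \<in> F - X. e \<inter> h' \<noteq> {}} \<subseteq> {f, h', k'}" using ext[OF h'(2,3,1)] by blast
  have "{g \<in> F - X. \<not> separated F f g} \<subseteq> {f, h, h', k, k'}"
  proof
    fix g assume "g \<in> {g \<in> F - X. \<not> separated F f g}"
    then obtain e where e: "g \<in> F - X" "e \<in> F" "e \<inter> f \<noteq> {}" "e \<inter> g \<noteq> {}"
      unfolding separated_def by blast
    then have "e \<in> {e \<in> F. a \<in> e} \<union> {e \<in> F. b \<in> e}" using ab by blast
    then have "e = f \<or> e = h \<or> e = h'" using h h' by blast
    then show "g \<in> {f, h, h', k, k'}"
    proof (elim disjE)
      assume "e = f"
      then have "g \<in> {e \<in> F. a \<in> e} \<union> {e \<in> F. b \<in> e}" using e ab by blast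
      then show ?thesis using h h' by blast
    next
      assume "e = h" then have "g \<in> {e \<in> F - X. e \<inter> h \<noteq> {}}" using e by blast
      then show ?thesis using k by blast
    next
      assume "e = h'" then have "g \<in> {e \<in> F - X. e \<inter> h' \<noteq> {}}" using e by blast
      then show ?thesis using k' by blast
    qed
  qed
  then have "card {g \<in> F - X. \<not> separated F f g} \<le> card {f, h, h', k, k'}"
    by (rule card_mono[rotated]) simp
  also have "\<dots> \<le> 5" using card_insert_le_m1 by (simp add: card_insert_if)
  finally show ?thesis .
qed

text \<open>Greedy choice: each chosen edge rules out at most five edges outside \<open>X\<close>,
  itself included. The first member is prescribed because it will have to satisfy a stronger
  condition.\<close>

lemma separated_family_exists:
  assumes F: "two_uniform F" "F0 \<subseteq> F"
    and B: "\<And>v. v \<notin> B \<Longrightarrow> deg F v \<in> {0, 2}"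
    and X: "X = {h \<in> F. h \<inter> B \<noteq> {}}"
    and g0: "g0 \<in> F0 - X" and c: "card X + 5 * t < card F0"
  shows "\<exists>g. g 0 = g0 \<and> (\<forall>i\<le>t. g i \<in> F0 - X) \<and>
    (\<forall>i\<le>t. \<forall>j\<le>t. i \<noteq> j \<longrightarrow> separated F (g i) (g j))"
  using c
proof (induction t)
  case 0
  then show ?case using g0 by (intro exI[of _ "\<lambda>_. g0"]) auto
next
  case (Suc t)
  then obtain g where g: "g 0 = g0" "\<And>i. i \<le> t \<Longrightarrow> g i \<in> F0 - X"
    "\<And>i j. i \<le> t \<Longrightarrow> j \<le> t \<Longrightarrow> i \<noteq> j \<Longrightarrow> separated F (g i) (g j)" by fastforce
  have finF: "finite F" using F by (auto simp: two_uniform_def)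
  define N where "N i = {h \<in> F - X. \<not> separated F (g i) h}" for i
  have N: "card (N i) \<le> 5" if "i \<le> t" for i
    unfolding N_def by (rule card_not_separated_le[OF F(1) B X]) (use g(2)[OF that] F(2) in auto)
  have "card (X \<union> (\<Union>i\<le>t. N i)) \<le> card X + card (\<Union>i\<le>t. N i)" by (rule card_Un_le)
  also have "card (\<Union>i\<le>t. N i) \<le> (\<Sum>i\<le>t. card (N i))" by (rule card_UN_le) simp
  also have "\<dots> \<le> (\<Sum>i\<le>t. 5)" by (rule sum_mono) (use N in auto)
  finally have "card (X \<union> (\<Union>i\<le>t. N i)) < card F0" using Suc.prems by simp
  moreover have "finite (X \<union> (\<Union>i\<le>t. N i))" using finF X by (simp add: N_def)
  ultimately have "\<not> F0 \<subseteq> X \<union> (\<Union>i\<le>t. N i)" using card_mono by (metis not_le)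
  then obtain h where h: "h \<in> F0" "h \<notin> X" "\<And>i. i \<le> t \<Longrightarrow> h \<notin> N i" by blast
  have hs: "separated F (g i) h" if "i \<le> t" for i using h(3)[OF that] h F(2) by (auto simp: N_def)
  show ?case
  proof (intro exI[of _ "g(Suc t := h)"] conjI allI impI)
    show "(g(Suc t := h)) 0 = g0" using g by simp
  next
    fix i assume "i \<le> Suc t" then show "(g(Suc t := h)) i \<in> F0 - X" using g(2) h by auto
  next
    fix i j assume "i \<le> Suc t" "j \<le> Suc t" "i \<noteq> j"
    then show "separated F ((g(Suc t := h)) i) ((g(Suc t := h)) j)"
      using g(3) hs separated_sym[OF hs] by auto
  qed
qed

section \<open>At most three closers\<close>

text \<open>Adding \<open>e\<close> and deleting \<open>g\<close> change degrees only at their ends,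
  so the condition can be read as one on the degrees in \<open>F\<close>. The first case is the one
  without a deleted edge.\<close>

lemma closers_degrees:
  assumes F: "two_uniform F" and e: "e \<in> closers F"
  obtains "\<forall>v. deg F v + (if v \<in> e then 1 else 0) \<in> {0, 2}"
  | g where "g \<in> F" "\<forall>v. deg F v + (if v \<in> e then 1 else 0) \<in> (if v \<in> g then {1, 3} else {0, 2})"
proof -
  have finF: "finite F" using F by (auto simp: two_uniform_def)
  obtain G where G: "e \<notin> F" "G \<subseteq> F" "card G \<le> 1" "\<And>v. deg (insert e F - G) v \<in> {0, 2}"
    using e by (auto simp: closers_def)
  have "finite G" using G(2) finF finite_subset by blast
  then consider "G = {}" | g where "G = {g}" using G(3) by (metis card_0_eq card_1_singletonE le_neq_implies_less less_one)
  then show ?thesis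
  proof cases
    case 1
    then show ?thesis using that(1) G(4) deg_insert[OF finF G(1)] by auto
  next
    case (2 g)
    have gF: "g \<in> F" using 2 G by blast
    have "deg F v + (if v \<in> e then 1 else 0) \<in> (if v \<in> g then {1, 3} else {0, 2})" for v
    proof -
      have "deg F v + (if v \<in> e then 1 else 0) = deg (insert e F - G) v + (if v \<in> g then 1 else 0)"
        using deg_insert[OF finF G(1), of v] deg_remove[of "insert e F" g v] finF gF 2 by simp
      moreover have "deg (insert e F - G) v = 0 \<or> deg (insert e F - G) v = 2" using G(4)[of v] by auto
      ultimately show ?thesis by (cases "v \<in> g") auto
    qed
    then show ?thesis using that(2) gF by blast
  qed
qed

text \<open>The odd vertices of \<open>F\<close> are those in exactly one of \<open>e\<close> and
  the deleted edge \<open>g\<close>, or the ends of \<open>e\<close> if nothing is deleted. As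
  \<open>e\<close> is not in \<open>F\<close>, it differs from \<open>g\<close>, and the two share
  at most one vertex \<open>z\<close>.\<close>

lemma closers_cases:
  assumes F: "two_uniform F" and e: "e \<in> closers F"
    and Q: "Q = {v. odd (deg F v)}"
  obtains (none) "Q = e" "\<And>v. v \<in> e \<Longrightarrow> deg F v = 1"
  | (disjoint) g where "g \<in> F" "e \<inter> g = {}" "Q = e \<union> g"
  | (adjacent) p q z where "e = {p, z}" "{q, z} \<in> F" "p \<noteq> q" "p \<noteq> z" "q \<noteq> z"
      "Q = {p, q}" "deg F p = 1" "deg F q \<in> {1, 3}"
proof -
  have e2: "card e = 2" "e \<notin> F" using e by (auto simp: closers_def)
  from closers_degrees[OF F e] show ?thesis
  proof cases
    case 1
    have "deg F v = 1" if "v \<in> e" for v using 1 that by (auto dest!: spec[of _ v])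
    moreover have "even (deg F v)" if "v \<notin> e" for v using 1 that by (auto dest!: spec[of _ v])
    ultimately have "Q = e" using Q by force
    then show ?thesis using none \<open>\<And>v. v \<in> e \<Longrightarrow> deg F v = 1\<close> by blast
  next
    case (2 g)
    have d: "deg F v + (if v \<in> e then 1 else 0) \<in> (if v \<in> g then {1, 3} else {0, 2})" for v
      using 2 by blast
    have parity: "v \<in> Q \<longleftrightarrow> (v \<in> e) \<noteq> (v \<in> g)" for v
      using d[of v] Q by (auto split: if_splits)
    have g2: "card g = 2" using 2 F by (auto simp: two_uniform_def)
    show ?thesis
    proof (cases "e \<inter> g = {}")
      case True
      then show ?thesis using disjoint[of g] 2 parity by blast
    next
      case False
      then obtain z where z: "z \<in> e" "z \<in> g" by blast
      obtain p where p: "e = {z, p}" "p \<noteq> z" using card_two_other[OF e2(1) z(1)] by metis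
      obtain q where q: "g = {z, q}" "q \<noteq> z" using card_two_other[OF g2 z(2)] by metis
      have pq: "p \<noteq> q" using p q 2 e2 by blast
      have "Q = {p, q}" using parity p q pq by auto
      moreover have "deg F p = 1"
      proof -
        have "finite F" "g \<in> F" using F 2 by (auto simp: two_uniform_def)
        have "odd (deg F p)" using Q \<open>Q = {p, q}\<close> by auto
        then show ?thesis using d[of p] p q pq by auto
      qed
      moreover have "deg F q \<in> {1, 3}" using d[of q] p q pq by auto
      ultimately show ?thesis using adjacent[of p z q] p q pq 2 by (metis insert_commute)
    qed
  qed
qed

text \<open>If a closer exists, \<open>F\<close> has two or four odd vertices. With two, a closer is
  the pair \<open>Q\<close> or joins one odd vertex to a neighbor of the other. With four, it is one
  half of a splitting of \<open>Q\<close> into two pairs whose other half is in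
  \<open>F\<close>.\<close>

lemma card_closers_le:
  assumes F: "two_uniform F"
  shows "finite (closers F) \<and> card (closers F) \<le> 3"
proof -
  have finF: "finite F" using F by (auto simp: two_uniform_def)
  have sub: ?thesis if "closers F \<subseteq> S" "finite S" "card S \<le> 3" for S
    using that by (meson card_mono finite_subset le_trans)
  define Q where "Q = {v. odd (deg F v)}"
  have notF: "e \<notin> F" "card e = 2" if "e \<in> closers F" for e using that by (auto simp: closers_def)
  show ?thesis
  proof (cases "card Q = 2")
    case True
    then obtain p q where pq: "Q = {p, q}" "p \<noteq> q" by (auto simp: card_2_iff)
    \<comment> \<open>Each edge \<open>{q, z}\<close> of \<open>F\<close> yields the candidate
      \<open>{p, z}\<close>, hence at most \<open>deg F q\<close> candidates.\<close>
    define S where "S p q = (\<lambda>g. insert p (g - {q})) ` {g \<in> F. q \<in> g}" for p q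
    have S: "card (S p q) \<le> deg F q" for p q
      unfolding S_def deg_def by (rule card_image_le) (use finF in auto)
    have finS: "finite (S p q)" for p q by (simp add: S_def finF)
    have mem: "e = Q \<and> deg F p = 1 \<and> deg F q = 1 \<or>
        e \<in> S p q \<and> deg F p = 1 \<and> deg F q \<in> {1, 3} \<or>
        e \<in> S q p \<and> deg F q = 1 \<and> deg F p \<in> {1, 3}"
      if e: "e \<in> closers F" for e
      using F e Q_def
    proof (cases rule: closers_cases)
      case none then show ?thesis using pq by auto
    next
      case (disjoint g)
      have "card g = 2" "card e = 2" using disjoint F notF[OF e] by (auto simp: two_uniform_def)
      then have "card Q = 4" using disjoint by (metis card_Un_disjoint card.infinite numeral_Bit0 zero_neq_numeral)
      then show ?thesis using True by simp
    next
      case (adjacent p' q' z)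
      have "e = insert p' ({q', z} - {q'})" using adjacent by auto
      then have "e \<in> S p' q'" unfolding S_def using adjacent by blast
      moreover have "p' = p \<and> q' = q \<or> p' = q \<and> q' = p" using adjacent pq by (auto simp: doubleton_eq_iff)
      ultimately show ?thesis using adjacent by blast
    qed
    \<comment> \<open>Degrees 1 and 1 allow \<open>Q\<close> and one candidate from each side.
      Degrees 1 and 3 exclude \<open>Q\<close> and allow one candidate for each of the three edges
      at the vertex of degree 3.\<close>
    consider "deg F p = 1" "deg F q = 1" | "deg F p = 1" "deg F q = 3" | "deg F q = 1" "deg F p = 3"
      | "closers F = {}" using mem by blast
    then show ?thesis
    proof cases
      case 1
      have "closers F \<subseteq> insert Q (S p q \<union> S q p)" using mem by blast
      moreover have "card (insert Q (S p q \<union> S q p)) \<le> 3"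
        using card_insert_le_m1[of 3 "S p q \<union> S q p" Q] card_Un_le[of "S p q" "S q p"] S[of p q] S[of q p] 1
        by simp
      ultimately show ?thesis using finS by (intro sub[of "insert Q (S p q \<union> S q p)"]) auto
    next
      case 2
      have "closers F \<subseteq> S p q" using mem 2 by auto
      then show ?thesis using finS S[of p q] 2 by (intro sub) auto
    next
      case 3
      have "closers F \<subseteq> S q p" using mem 3 by auto
      then show ?thesis using finS S[of q p] 3 by (intro sub) auto
    next
      case 4 then show ?thesis by simp
    qed
  next
    case False
    have mem: "e \<subseteq> Q \<and> Q - e \<in> F \<and> card Q = 4" if e: "e \<in> closers F" for e
      using F e Q_def
    proof (cases rule: closers_cases)
      case none then show ?thesis using False notF[OF e] by auto
    next
      case (disjoint g)
      have "card g = 2" "card e = 2" using disjoint F notF[OF e] by (auto simp: two_uniform_def)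
      then have "card Q = 4" using disjoint by (metis card_Un_disjoint card.infinite numeral_Bit0 zero_neq_numeral)
      moreover have "Q - e = g" using disjoint by blast
      ultimately show ?thesis using disjoint by auto
    next
      case (adjacent p' q' z)
      then show ?thesis using False by simp
    qed
    show ?thesis
    proof (cases "closers F = {}")
      case True then show ?thesis by simp
    next
      case ne: False
      then have c4: "card Q = 4" using mem by blast
      then obtain a b c d where abcd: "Q = {a, b, c, d}" "distinct [a, b, c, d]"
        by (auto simp: card_Suc_eq numeral_eq_Suc)
      \<comment> \<open>Each of the three splittings of \<open>Q\<close> into two pairs contains at
        most one closer: a closer is not in \<open>F\<close>, whereas the opposite pair is.\<close>
      define pick where "pick x y u w = (if {x, y} \<in> F then {u, w} else {x, y})" for x y u w
      have "closers F \<subseteq> {pick a b c d, pick a c b d, pick a d b c}"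
      proof
        fix e assume e: "e \<in> closers F"
        then have m: "e \<subseteq> Q" "Q - e \<in> F" "e \<notin> F" "card e = 2" using mem notF by auto
        obtain u w where uw: "e = {u, w}" "u \<noteq> w" using m(4) by (auto simp: card_2_iff)
        have "u \<in> {a,b,c,d}" "w \<in> {a,b,c,d}" using uw m abcd by auto
        then have "e = {a,b} \<or> e = {c,d} \<or> e = {a,c} \<or> e = {b,d} \<or> e = {a,d} \<or> e = {b,c}"
          using uw by auto
        moreover have "{a,b,c,d} - {c,d} = {a,b}" "{a,b,c,d} - {b,d} = {a,c}" "{a,b,c,d} - {b,c} = {a,d}"
          using abcd(2) by auto
        ultimately show "e \<in> {pick a b c d, pick a c b d, pick a d b c}"
          using m(2,3) abcd(1) unfolding pick_def by (elim disjE) auto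
      qed
      then show ?thesis by (rule sub) (auto simp: card_insert_if)
    qed
  qed
qed

section \<open>Few edges touch irregular vertices or added edges\<close>

text \<open>The ends of a closer are odd vertices, hence in \<open>B\<close>, except for the common
  vertex \<open>z\<close> in the adjacent case. If \<open>z\<close> is outside \<open>B\<close>, it
  has degree 2 and one of its edges leads to the odd vertex \<open>q\<close>, so at most one edge at
  \<open>z\<close> avoids \<open>B\<close>.\<close>

lemma card_closer_new_edges_le:
  assumes F: "two_uniform F" and e: "e \<in> closers F"
    and B: "\<And>v. v \<notin> B \<Longrightarrow> deg F v \<in> {0, 2}"
  shows "card {h \<in> F. h \<inter> e \<noteq> {} \<and> h \<inter> B = {}} \<le> 1"
proof -
  have finF: "finite F" using F by (auto simp: two_uniform_def)
  have sub: "{v. odd (deg F v)} \<subseteq> B" using B by force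
  have main: ?thesis if z: "e \<subseteq> insert z B" "g \<in> F" "z \<in> g" "g \<inter> B \<noteq> {}" for z g
  proof (cases "z \<in> B")
    case True
    then have "{h \<in> F. h \<inter> e \<noteq> {} \<and> h \<inter> B = {}} = {}" using z by blast
    then show ?thesis by (simp only: card.empty)
  next
    case False
    have "deg F z \<noteq> 0" using z finF by (auto simp: deg_def)
    then have "deg F z = 2" using B[OF False] by simp
    then obtain k where k: "{h \<in> F. z \<in> h} = {g, k}"
      using deg_two_edges[OF finF _ z(2,3)] by metis
    have "{h \<in> F. h \<inter> e \<noteq> {} \<and> h \<inter> B = {}} \<subseteq> {k}"
    proof
      fix h assume h: "h \<in> {h \<in> F. h \<inter> e \<noteq> {} \<and> h \<inter> B = {}}"
      then have "h \<in> {h \<in> F. z \<in> h}" "h \<noteq> g" using z by blast+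
      then show "h \<in> {k}" using k by blast
    qed
    then show ?thesis using card_mono[of "{k}"] by fastforce
  qed
  have none: ?thesis if "e \<subseteq> B"
  proof -
    have "{h \<in> F. h \<inter> e \<noteq> {} \<and> h \<inter> B = {}} = {}" using that by blast
    then show ?thesis by (simp only: card.empty)
  qed
  from F e refl show ?thesis
  proof (cases rule: closers_cases)
    case none': none then show ?thesis using none sub by blast
  next
    case (disjoint g) then show ?thesis using none sub by blast
  next
    case (adjacent p q z)
    show ?thesis
      by (rule main[of z "{q, z}"]) (use adjacent sub in blast)+
  qed
qed

text \<open>
  Here \<open>f j\<close> is the edge of \<open>F\<close> whose color is given to \<open>e j\<close>, \<open>F0\<close> is a rainbow part of \<open>F\<close>,
  and \<open>K\<close> is the edge set of the rainbow path through \<open>e t\<close>.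
\<close>

definition path_extending :: "nat \<Rightarrow> 'a set set \<Rightarrow> 'a set set \<Rightarrow> (nat \<Rightarrow> 'a set) \<Rightarrow> nat \<Rightarrow> bool" where
  "path_extending l F F0 e t \<longleftrightarrow>
     (\<forall>f. inj_on f {..t} \<and> f ` {..t} \<subseteq> F0 \<longrightarrow>
       (\<exists>K x y. K \<subseteq> F \<union> e ` {..t} \<and> e t \<in> K \<and> card K = l - 1 \<and> path_degrees K x y \<and>
          f t \<notin> K \<and> (\<forall>j<t. \<not> (e j \<in> K \<and> f j \<in> K))))"

text \<open>The first count provides an edge of \<open>F0\<close> that touches no edge of
  \<open>X\<close>; it becomes \<open>f t\<close>. The second provides \<open>t\<close> more edges,
  separated from it and from each other. The path that \<open>ext\<close> gives for this family
  satisfies the conditions of \<open>closers_step\<close>.\<close>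

lemma closer_if_few_bad_edges:
  assumes F: "two_uniform F" "card F \<le> l" "F0 \<subseteq> F" "1 \<le> l"
    and e: "\<And>j. j \<le> t \<Longrightarrow> e j \<notin> F \<and> card (e j) = 2" "inj_on e {..t}"
    and ext: "path_extending l F F0 e t"
    and X: "X = {h \<in> F. h \<inter> ({v. deg F v \<notin> {0, 2}} \<union> \<Union> (e ` {..t})) \<noteq> {}}"
    and c: "2 * card X < card F0" "card X + 5 * t < card F0"
  shows "e t \<in> closers F"
proof -
  define B where "B = {v. deg F v \<notin> {0, 2}} \<union> \<Union> (e ` {..t})"
  have XB: "X = {h \<in> F. h \<inter> B \<noteq> {}}" using X by (simp add: B_def)
  have B: "deg F v \<in> {0, 2}" "\<And>i. i \<le> t \<Longrightarrow> v \<notin> e i" if "v \<notin> B" for v using that by (auto simp: B_def)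
  have finF: "finite F" and c2: "\<And>h. h \<in> F \<Longrightarrow> card h = 2" using F by (auto simp: two_uniform_def)
  have two: "deg F v = 2" if "v \<notin> B" "h \<in> F" "v \<in> h" for v h
  proof -
    have "deg F v \<noteq> 0" using that finF by (auto simp: deg_def)
    then show ?thesis using B(1)[OF that(1)] by simp
  qed
  define N where "N = {h \<in> F. \<exists>h'\<in>X. h \<inter> h' \<noteq> {}}"
  have "card N \<le> 2 * card X" unfolding N_def by (rule card_meeting_met_le[OF F(1) B(1) XB])
  then have "\<not> F0 \<subseteq> N" using c(1) card_mono[of N F0] finF by (auto simp: N_def)
  then obtain g0 where g0: "g0 \<in> F0" "g0 \<notin> N" by blast
  have g0X: "g0 \<notin> X" using g0 F(3) XB unfolding N_def by blast
  obtain g where g: "g 0 = g0" "\<And>i. i \<le> t \<Longrightarrow> g i \<in> F0 - X"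
    "\<And>i j. i \<le> t \<Longrightarrow> j \<le> t \<Longrightarrow> i \<noteq> j \<Longrightarrow> separated F (g i) (g j)"
    using separated_family_exists[OF F(1,3) B(1) XB _ c(2), of g0] g0 g0X by blast
  \<comment> \<open>The order is reversed so that the prescribed edge \<open>g0\<close> gets the
    index \<open>t\<close>.\<close>
  define f where "f j = g (t - j)" for j
  have fF: "f j \<in> F0" "f j \<in> F" "f j \<notin> X" "f j \<noteq> {}" if "j \<le> t" for j
    using g(2)[of "t - j"] F(3) c2[of "f j"] by (auto simp: f_def)
  have sep: "separated F (f i) (f j)" if "i \<le> t" "j \<le> t" "i \<noteq> j" for i j
    using g(3)[of "t - i" "t - j"] that by (simp add: f_def)
  have disj: "f i \<inter> f j = {}" if "i \<le> t" "j \<le> t" "i \<noteq> j" for i j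
    using separated_disjoint[OF sep[OF that]] fF that by blast
  have "inj_on f {..t}"
  proof (rule inj_onI)
    fix i j assume "i \<in> {..t}" "j \<in> {..t}" "f i = f j"
    then show "i = j" using disj[of i j] fF(4)[of i] by auto
  qed
  moreover have "f ` {..t} \<subseteq> F0" using fF by auto
  ultimately obtain K x y where K: "K \<subseteq> F \<union> e ` {..t}" "e t \<in> K" "card K = l - 1" "path_degrees K x y"
    "f t \<notin> K" "\<And>j. j < t \<Longrightarrow> \<not> (e j \<in> K \<and> f j \<in> K)"
    using ext unfolding path_extending_def by meson
  show ?thesis
  proof (rule closers_step[where f = f and K = K and x = x and y = y and l = l])
    fix j v assume jv: "j \<le> t" "v \<in> f j"
    then have "v \<notin> B" using fF[of j] XB by blast
    then show "deg F v = 2 \<and> (\<forall>i\<le>t. v \<notin> e i)" using two[of v "f j"] B(2) jv fF(2) by blast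
  next
    fix h v assume h: "h \<in> F" "h \<inter> f t \<noteq> {}" "v \<in> h"
    have "f t = g0" using g(1) by (simp add: f_def)
    then have "h \<notin> X" using g0 h F(3) by (auto simp: N_def)
    then have "v \<notin> B" using XB h by blast
    then show "deg F v = 2 \<and> v \<notin> e t" using two[of v h] B(2) h by blast
  qed (use F e K fF sep disj \<open>inj_on f {..t}\<close> in auto)
qed

lemma path_degrees_le: "path_degrees K x y \<Longrightarrow> deg K v \<le> 2"
  unfolding path_degrees_def by (cases "v \<in> {x, y}") fastforce+

text \<open>\<open>F\<close> has at most two edges outside \<open>K\<close>, and every irregular
  vertex is a path end, an end of \<open>e\<close> or an end of one of these. The count is 2 for the
  edges outside \<open>K\<close>, and for the edges of \<open>K\<close> other than \<open>e\<close>: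
  2 at the path ends, 2 at \<open>e\<close> and 4 at each of the two missed edges.\<close>

lemma card_bad_edges_first:
  assumes F: "two_uniform F" "card F \<le> l" "1 \<le> l" and e: "card e = 2" "e \<notin> F"
    and K: "K \<subseteq> insert e F" "e \<in> K" "card K = l - 1" "path_degrees K x y"
  shows "card {h \<in> F. h \<inter> ({v. deg F v \<notin> {0, 2}} \<union> e) \<noteq> {}} \<le> 14"
proof -
  have finF: "finite F" and c2: "\<And>h. h \<in> F \<Longrightarrow> card h = 2" using F by (auto simp: two_uniform_def)
  have finK: "finite K" using K(1) finF finite_subset by blast
  define H where "H = F - K"
  have "card (insert e F - K) = card (insert e F) - card K"
    using finK K(1) by (simp add: card_Diff_subset)
  moreover have "card (insert e F) \<le> l + 1" using card_insert_le_m1[of "l + 1" F e] F(2) by simp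
  moreover have "H = insert e F - K" using K(2) by (auto simp: H_def)
  ultimately have cH: "card H \<le> 2" using K(3) F(3) by simp
  have finH: "finite H" by (simp add: H_def finF)
  define KE where "KE = K - {e}"
  have FKH: "F \<subseteq> KE \<union> H" using e(2) by (auto simp: KE_def H_def)
  have dKE: "deg KE v \<le> deg K v" for v unfolding KE_def by (rule deg_mono) (use finK in auto)
  have d2: "deg KE v \<le> 2" for v using dKE[of v] path_degrees_le[OF K(4), of v] by simp
  have finKE: "finite KE" by (simp add: KE_def finK)
  define Y where "Y V = {h \<in> KE. h \<inter> V \<noteq> {}}" for V
  have Yxy: "card (Y {x, y}) \<le> 2"
  proof -
    have "card (Y {x, y}) \<le> (\<Sum>v\<in>{x, y}. deg KE v)" unfolding Y_def by (rule card_meeting_le) (use finKE in auto)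
    also have "\<dots> = deg KE x + deg KE y" using K(4) by (simp add: path_degrees_def)
    also have "\<dots> \<le> 2" using dKE[of x] dKE[of y] K(4) by (simp add: path_degrees_def)
    finally show ?thesis .
  qed
  have Ye: "card (Y e) \<le> 2"
  proof -
    have "deg KE v \<le> 1" if "v \<in> e" for v
      using deg_remove[OF finK K(2), of v] path_degrees_le[OF K(4), of v] that by (simp add: KE_def)
    then show ?thesis using card_meeting_edge_le[OF finKE e(1), of 1] by (simp add: Y_def)
  qed
  have YH: "card (\<Union>h\<in>H. Y h) \<le> 8"
  proof -
    have "card (Y h) \<le> 4" if "h \<in> H" for h
      using card_meeting_edge_le[OF finKE c2, of h 2] d2 that by (simp add: Y_def H_def)
    then have "(\<Sum>h\<in>H. card (Y h)) \<le> (\<Sum>h\<in>H. 4)" by (intro sum_mono)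
    then show ?thesis using card_UN_le[OF finH, of Y] cH by simp
  qed
  have "{v. deg F v \<notin> {0, 2}} \<subseteq> {x, y} \<union> e \<union> \<Union>H"
  proof
    fix v assume v: "v \<in> {v. deg F v \<notin> {0, 2}}"
    show "v \<in> {x, y} \<union> e \<union> \<Union>H"
    proof (rule ccontr)
      assume n: "v \<notin> {x, y} \<union> e \<union> \<Union>H"
      then have "{h \<in> F. v \<in> h} = {h \<in> K. v \<in> h}" using K(1) by (auto simp: H_def)
      then have "deg F v = deg K v" by (simp add: deg_def)
      then show False using v n K(4) by (auto simp: path_degrees_def)
    qed
  qed
  then have "{h \<in> F. h \<inter> ({v. deg F v \<notin> {0, 2}} \<union> e) \<noteq> {}} \<subseteq> {h \<in> F. h \<inter> ({x, y} \<union> e \<union> \<Union>H) \<noteq> {}}"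
    by blast
  also have "\<dots> \<subseteq> H \<union> (Y {x, y} \<union> (Y e \<union> (\<Union>h\<in>H. Y h)))"
    unfolding Y_def using FKH by blast
  finally have "card {h \<in> F. h \<inter> ({v. deg F v \<notin> {0, 2}} \<union> e) \<noteq> {}}
      \<le> card (H \<union> (Y {x, y} \<union> (Y e \<union> (\<Union>h\<in>H. Y h))))"
    by (rule card_mono[rotated]) (use finH finKE in \<open>auto simp: Y_def\<close>)
  also have "\<dots> \<le> card H + (card (Y {x, y}) + (card (Y e) + card (\<Union>h\<in>H. Y h)))"
    by (meson add_left_mono card_Un_le le_trans)
  finally show ?thesis using cH Yxy Ye YH by simp
qed

text \<open>Adding the closer \<open>e 0\<close> and deleting at most one edge makes all degrees 0
  or 2, so only the ends of these two edges are irregular in \<open>F\<close>. At most 7 edges touch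
  them. Each closer \<open>e i\<close> with \<open>0 < i < t\<close> adds at most one edge and the
  arbitrary non-edge \<open>e t\<close> at most four, in total
  \<open>7 + (t - 1) + 4\<close>.\<close>

lemma card_bad_edges_later:
  assumes F: "two_uniform F"
    and cl: "\<And>i. i < t \<Longrightarrow> e i \<in> closers F" and et: "card (e t) = 2"
    and t: "1 \<le> t"
  shows "card {h \<in> F. h \<inter> ({v. deg F v \<notin> {0, 2}} \<union> \<Union> (e ` {..t})) \<noteq> {}} \<le> 10 + t"
proof -
  have finF: "finite F" and c2: "\<And>h. h \<in> F \<Longrightarrow> card h = 2" using F by (auto simp: two_uniform_def)
  obtain G where G: "e 0 \<notin> F" "card (e 0) = 2" "G \<subseteq> F" "card G \<le> 1"
    "\<And>v. deg (insert (e 0) F - G) v \<in> {0, 2}"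
    using cl[of 0] t by (auto simp: closers_def)
  have finG: "finite G" using G(3) finF finite_subset by blast
  define Z where "Z = insert (e 0) F - G"
  have finZ: "finite Z" by (simp add: Z_def finF)
  have e0Z: "e 0 \<in> Z" using G by (auto simp: Z_def)
  define Z' where "Z' = Z - {e 0}"
  have FZ: "F = Z' \<union> G" using G by (auto simp: Z'_def Z_def)
  have finZ': "finite Z'" by (simp add: Z'_def finZ)
  have dZ: "deg Z v \<le> 2" for v using G(5)[of v] by (auto simp: Z_def)
  define B where "B = e 0 \<union> \<Union>G"
  have B: "deg F v \<in> {0, 2}" if "v \<notin> B" for v
  proof -
    have "{h \<in> F. v \<in> h} = {h \<in> Z. v \<in> h}" using that by (auto simp: B_def Z_def)
    then show ?thesis using G(5)[of v] by (simp add: deg_def Z_def)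
  qed
  define X1 where "X1 = {h \<in> F. h \<inter> B \<noteq> {}}"
  \<comment> \<open>The deleted edge itself, two edges at the ends of \<open>e 0\<close> and four at
    the ends of the deleted edge.\<close>
  have X1: "card X1 \<le> 7"
  proof -
    have 1: "card {h \<in> Z'. h \<inter> e 0 \<noteq> {}} \<le> 2"
    proof -
      have "deg Z' v \<le> 1" if "v \<in> e 0" for v
        using deg_remove[OF finZ e0Z, of v] dZ[of v] that by (simp add: Z'_def)
      then show ?thesis using card_meeting_edge_le[OF finZ' G(2), of 1] by simp
    qed
    have "card {h \<in> Z'. h \<inter> g \<noteq> {}} \<le> 4" if "g \<in> G" for g
    proof -
      have "deg Z' v \<le> 2" for v
        using deg_mono[OF finZ, of Z' v] dZ[of v] by (auto simp: Z'_def)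
      then show ?thesis using card_meeting_edge_le[OF finZ' c2, of g 2] G(3) that by auto
    qed
    then have "(\<Sum>g\<in>G. card {h \<in> Z'. h \<inter> g \<noteq> {}}) \<le> (\<Sum>g\<in>G. 4)" by (intro sum_mono)
    then have 2: "card (\<Union>g\<in>G. {h \<in> Z'. h \<inter> g \<noteq> {}}) \<le> 4"
      using card_UN_le[OF finG, of "\<lambda>g. {h \<in> Z'. h \<inter> g \<noteq> {}}"] G(4) by simp
    have "X1 \<subseteq> G \<union> ({h \<in> Z'. h \<inter> e 0 \<noteq> {}} \<union> (\<Union>g\<in>G. {h \<in> Z'. h \<inter> g \<noteq> {}}))"
      unfolding X1_def B_def using FZ by blast
    then have "card X1 \<le> card (G \<union> ({h \<in> Z'. h \<inter> e 0 \<noteq> {}} \<union> (\<Union>g\<in>G. {h \<in> Z'. h \<inter> g \<noteq> {}})))"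
      by (rule card_mono[rotated]) (use finG finZ' in auto)
    also have "\<dots> \<le> card G + (card {h \<in> Z'. h \<inter> e 0 \<noteq> {}} + card (\<Union>g\<in>G. {h \<in> Z'. h \<inter> g \<noteq> {}}))"
      by (meson add_left_mono card_Un_le le_trans)
    finally show ?thesis using 1 2 G(4) by simp
  qed
  define Y where "Y i = {h \<in> F. h \<inter> e i \<noteq> {} \<and> h \<inter> B = {}}" for i
  have finY: "finite (Y i)" for i by (simp add: Y_def finF)
  have Y: "card (\<Union>i\<in>{1..<t}. Y i) \<le> t - 1"
  proof -
    have "card (Y i) \<le> 1" if "i \<in> {1..<t}" for i
      unfolding Y_def using card_closer_new_edges_le[OF F cl B] that by auto
    then have "(\<Sum>i\<in>{1..<t}. card (Y i)) \<le> (\<Sum>i\<in>{1..<t}. 1)" by (intro sum_mono)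
    then show ?thesis using card_UN_le[of "{1..<t}" Y] by simp
  qed
  have Yt: "card (Y t) \<le> 4"
  proof -
    define F' where "F' = {h \<in> F. h \<inter> B = {}}"
    have "deg F' v \<le> 2" for v
    proof (cases "v \<in> B")
      case True
      then have "{h \<in> F'. v \<in> h} = {}" by (auto simp: F'_def)
      then show ?thesis unfolding deg_def by (metis card.empty zero_le)
    next
      case False
      then show ?thesis using deg_mono[OF finF, of F' v] B[of v] by (auto simp: F'_def)
    qed
    then have "card {h \<in> F'. h \<inter> e t \<noteq> {}} \<le> 2 * 2"
      by (intro card_meeting_edge_le) (use finF et in \<open>auto simp: F'_def\<close>)
    moreover have "{h \<in> F'. h \<inter> e t \<noteq> {}} = Y t" by (auto simp: F'_def Y_def)
    ultimately show ?thesis by simp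
  qed
  have split: "{..t} = insert 0 (insert t {1..<t})" using t by auto
  have "{h \<in> F. h \<inter> ({v. deg F v \<notin> {0, 2}} \<union> \<Union> (e ` {..t})) \<noteq> {}} \<subseteq> X1 \<union> ((\<Union>i\<in>{1..<t}. Y i) \<union> Y t)"
  proof
    fix h assume h: "h \<in> {h \<in> F. h \<inter> ({v. deg F v \<notin> {0, 2}} \<union> \<Union> (e ` {..t})) \<noteq> {}}"
    then obtain v where v: "v \<in> h" "h \<in> F" "deg F v \<notin> {0, 2} \<or> (\<exists>i\<le>t. v \<in> e i)" by auto
    show "h \<in> X1 \<union> ((\<Union>i\<in>{1..<t}. Y i) \<union> Y t)"
    proof (cases "h \<inter> B = {}")
      case False then show ?thesis using v by (auto simp: X1_def)
    next
      case True
      then have "v \<notin> B" using v by blast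
      then obtain i where i: "i \<le> t" "v \<in> e i" "i \<noteq> 0" using v(3) B[of v] B_def by (metis UnI1)
      then have "h \<in> Y i" using True v by (auto simp: Y_def)
      then show ?thesis using i by (cases "i = t") auto
    qed
  qed
  then have "card {h \<in> F. h \<inter> ({v. deg F v \<notin> {0, 2}} \<union> \<Union> (e ` {..t})) \<noteq> {}}
      \<le> card (X1 \<union> ((\<Union>i\<in>{1..<t}. Y i) \<union> Y t))"
    by (rule card_mono[rotated]) (use finF finY in \<open>auto simp: X1_def\<close>)
  also have "\<dots> \<le> card X1 + (card (\<Union>i\<in>{1..<t}. Y i) + card (Y t))"
    by (meson add_left_mono card_Un_le le_trans)
  finally show ?thesis using X1 Y Yt t by simp
qed


text \<open>\<open>F0\<close> has at least 29 edges, and the bounds just suffice: 14 bad edges give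
  \<open>2 * 14 < 29\<close> for \<open>t = 0\<close>, and 13 give \<open>13 + 15 < 29\<close> for
  \<open>t = 3\<close>. So all four non-edges are closers, one more than
  \<open>card_closers_le\<close> allows.\<close>

lemma not_path_extending:
  assumes F: "two_uniform F" "card F \<le> l" "F0 \<subseteq> F" "l \<le> card F0 + 1" "30 \<le> l"
    and e: "\<And>j. j < 4 \<Longrightarrow> e j \<notin> F \<and> card (e j) = 2" "inj_on e {..<4}"
    and ext: "\<And>t. t < 4 \<Longrightarrow> path_extending l F F0 e t"
  shows False
proof -
  define X where "X t = {h \<in> F. h \<inter> ({v. deg F v \<notin> {0, 2}} \<union> \<Union> (e ` {..t})) \<noteq> {}}" for t
  have step: "e t \<in> closers F" if "t < 4" "2 * card (X t) < 29" "card (X t) + 5 * t < 29" for t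
  proof (rule closer_if_few_bad_edges[OF F(1-3) _ _ _ ext X_def])
    show "inj_on e {..t}" by (rule inj_on_subset[OF e(2)]) (use that in auto)
  qed (use that F e in auto)
  have "e t \<in> closers F" if "t < 4" for t
    using that
  proof (induction t rule: less_induct)
    case (less t)
    show ?case
    proof (cases "t = 0")
      case True
      \<comment> \<open>Any edge of \<open>F0\<close> can play the part of \<open>f 0\<close>, since
        only the degrees and the size of the resulting path matter here.\<close>
      obtain f0 where "f0 \<in> F0" using F(4,5) by fastforce
      then have "inj_on (\<lambda>_. f0) {..0::nat}" "(\<lambda>_. f0) ` {..0::nat} \<subseteq> F0" by auto
      then obtain K x y where "K \<subseteq> F \<union> e ` {..0}" "e 0 \<in> K" "card K = l - 1" "path_degrees K x y"
        using ext[of 0] unfolding path_extending_def by (meson zero_less_numeral)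
      then have "card (X 0) \<le> 14"
        using card_bad_edges_first[OF F(1,2), of "e 0" K x y] e(1)[of 0] F(5) by (simp add: X_def)
      then show ?thesis using step[of 0] True by simp
    next
      case False
      then have "card (X t) \<le> 10 + t"
        unfolding X_def by (intro card_bad_edges_later F) (use less e(1) in auto)
      then show ?thesis using step[of t] less.prems by simp
    qed
  qed
  then have "e ` {..<4} \<subseteq> closers F" by auto
  then have "card (e ` {..<4}) \<le> 3" using card_closers_le[OF F(1)] card_mono le_trans by meson
  then show False using e(2) by (simp add: card_image)
qed

section \<open>The adversary's colorings\<close>

lemma path_copy_degrees:
  assumes "copy_of (path_graph l) G K" "2 \<le> l"
  shows "card (edges K) = l - 1 \<and> (\<exists>x y. path_degrees (edges K) x y)"
proof -
  obtain f where f: "bij_betw f {..<l} (verts K)"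
    and E: "edges K = (\<lambda>e. f ` e) ` {{i, Suc i} | i. Suc i < l}"
    using assms(1) by (auto simp: copy_of_def isomorphic_def path_graph_def)
  define p where "p i = {f i, f (Suc i)}" for i
  have inj: "f i = f j \<longleftrightarrow> i = j" if "i < l" "j < l" for i j
    using f that by (auto simp: bij_betw_def inj_on_def)
  have EP: "edges K = p ` {..<l - 1}"
  proof -
    have "{{i, Suc i} | i. Suc i < l} = (\<lambda>i. {i, Suc i}) ` {..<l - 1}" by auto
    then show ?thesis unfolding E p_def by (simp add: image_image)
  qed
  have injp: "inj_on p {..<l - 1}"
  proof (rule inj_onI)
    fix i j assume "i \<in> {..<l - 1}" "j \<in> {..<l - 1}" "p i = p j"
    then show "i = j" using inj[of i j] inj[of "Suc i" j] inj[of i "Suc j"]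
      by (auto simp: p_def doubleton_eq_iff)
  qed
  have degK: "deg (edges K) v = card {j. j < l - 1 \<and> (f j = v \<or> f (Suc j) = v)}" for v
  proof -
    have "{h \<in> edges K. v \<in> h} = p ` {j. j < l - 1 \<and> (f j = v \<or> f (Suc j) = v)}"
      unfolding EP by (auto simp: p_def)
    then show ?thesis unfolding deg_def
      by (simp add: card_image inj_on_subset[OF injp] subset_iff)
  qed
  have degf: "deg (edges K) (f i) = card {j. j < l - 1 \<and> (j = i \<or> Suc j = i)}" if "i < l" for i
  proof -
    have "{j. j < l - 1 \<and> (f j = f i \<or> f (Suc j) = f i)} = {j. j < l - 1 \<and> (j = i \<or> Suc j = i)}"
      using inj that by auto
    then show ?thesis using degK by simp
  qed
  have "deg (edges K) (f 0) = 1"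
  proof -
    have "{j. j < l - 1 \<and> (j = 0 \<or> Suc j = 0)} = {0}" using assms(2) by auto
    then show ?thesis using degf[of 0] assms(2) by simp
  qed
  moreover have "deg (edges K) (f (l - 1)) = 1"
  proof -
    have "{j. j < l - 1 \<and> (j = l - 1 \<or> Suc j = l - 1)} = {l - 2}" using assms(2) by auto
    then show ?thesis using degf[of "l - 1"] assms(2) by simp
  qed
  moreover have "deg (edges K) v \<in> {0, 2}" if v: "v \<notin> {f 0, f (l - 1)}" for v
  proof (cases "v \<in> f ` {..<l}")
    case True
    then obtain i where i: "i < l" "v = f i" by auto
    have "i \<noteq> 0" using v i(2) by (metis insertI1)
    moreover have "i \<noteq> l - 1" using v i(2) by (metis insertI1 insertI2)
    ultimately have "{j. j < l - 1 \<and> (j = i \<or> Suc j = i)} = {i - 1, i}" using i by auto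
    then show ?thesis using degf[OF i(1)] i v by (cases "i = 0") auto
  next
    case False
    then have "{j. j < l - 1 \<and> (f j = v \<or> f (Suc j) = v)} = {}" by auto
    then have "deg (edges K) v = 0" using degK[of v] by (simp only: card.empty)
    then show ?thesis by simp
  qed
  moreover have "f 0 \<noteq> f (l - 1)" using inj[of 0 "l - 1"] assms(2) by simp
  ultimately have "path_degrees (edges K) (f 0) (f (l - 1))" by (simp add: path_degrees_def)
  then show ?thesis using EP injp by (auto simp: card_image)
qed

text \<open>Elements outside \<open>M\<close> get distinct colors of \<open>C\<close> that do not
  occur on \<open>M\<close>; infinitely many of these remain.\<close>

lemma extend_injective_coloring:
  assumes "finite N" "infinite C" "M \<subseteq> N" "inj_on c0 M" "c0 ` M \<subseteq> C"
  obtains c where "inj_on c N" "c ` N \<subseteq> C" "\<And>x. x \<in> M \<Longrightarrow> c x = c0 x"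
proof -
  have "finite (c0 ` M)" using assms(1,3) by (simp add: finite_subset)
  then have "infinite (C - c0 ` M)" using assms(2) by simp
  then obtain h :: "nat \<Rightarrow> _" where h: "inj h" "range h \<subseteq> C - c0 ` M"
    using infinite_countable_subset by metis
  obtain g :: "_ \<Rightarrow> nat" where g: "inj_on g N" using assms(1) finite_imp_inj_to_nat_seg by metis
  define c where "c x = (if x \<in> M then c0 x else h (g x))" for x
  have hC: "h i \<in> C" for i using h(2) by auto
  have hM: "h i \<noteq> c0 y" if "y \<in> M" for i y using h(2) that by auto
  show ?thesis
  proof (rule that[of c])
    show "inj_on c N"
    proof (rule inj_onI)
      fix x y assume xy: "x \<in> N" "y \<in> N" "c x = c y"
      then show "x = y"
        using inj_onD[OF assms(4), of x y] injD[OF h(1), of "g x" "g y"] inj_onD[OF g, of x y]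
          hM[of x "g y"] hM[of y "g x"]
        by (auto simp: c_def split: if_splits)
    qed
    show "c ` N \<subseteq> C" using assms(5) hC by (auto simp: c_def)
  qed (simp add: c_def)
qed

text \<open>\<open>n choose 2\<close> is at least \<open>n + 4\<close>, while \<open>F\<close> has
  fewer than \<open>n\<close> edges. The adversary needs four non-edges to play on.\<close>

lemma four_le_card_nonedges:
  assumes F: "simple_graph F" "verts F = {..<n}" "card (edges F) < n" "31 \<le> n"
  shows "4 \<le> card (edges (complement F))"
proof -
  have "31 * (n - 1) \<le> n * (n - 1)" using assms(4) by simp
  moreover have "2 * (n + 4) \<le> 31 * (n - 1)" using assms(4) by (cases n) auto
  ultimately have "2 * (n + 4) \<le> n * (n - 1)" by (rule le_trans[rotated])
  then have "n + 4 \<le> n choose 2" using div_le_mono[of "2 * (n + 4)" "n * (n - 1)" 2]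
    unfolding choose_two nonzero_mult_div_cancel_left[OF zero_neq_numeral[symmetric]] by blast
  moreover have "card {e. e \<subseteq> verts F \<and> card e = 2} = n choose 2"
    unfolding F(2) using n_subsets[of "{..<n}" 2] by simp
  moreover have "card {e. e \<subseteq> verts F \<and> card e = 2} - card (edges F) \<le> card (edges (complement F))"
    unfolding complement_def using F
    by (simp add: diff_card_le_card_Diff finite_subset[of "edges F" "Pow {..<n}"] simple_graph_def subset_iff)
  ultimately show ?thesis using F(3) by simp
qed

text \<open>The adversary copies colors of edges of \<open>F\<close> to the first four non-edges of
  the ordering. Copying several at once needs edges of different colors, so a rainbow part
  \<open>F0\<close> of \<open>F\<close> with \<open>l - 1\<close> edges is found first; then
  \<open>not_path_extending\<close> applies.\<close>

lemma weakly_rainbow_saturated_card_ge: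
  fixes F :: "nat graph" and C :: "'a set"
  assumes "infinite C" "verts F = {..<n}" "edge_colored_graph C F k"
    and sat: "weakly_rainbow_saturated C (path_graph l) F k"
    and "30 \<le> l" "l + 1 \<le> n"
  shows "l + 1 \<le> card (edges F)"
proof (rule ccontr)
  assume "\<not> ?thesis"
  then have cF: "card (edges F) \<le> l" by simp
  have sF: "simple_graph F" and kC: "k \<in> edges F \<rightarrow> C" using assms(3) by (auto simp: edge_colored_graph_def)
  have finF: "finite (edges F)"
    using finite_subset[of "edges F" "Pow (verts F)"] sF by (auto simp: simple_graph_def)
  have tF: "two_uniform (edges F)" using sF finF by (auto simp: two_uniform_def simple_graph_def)
  define N where "N = edges (complement F)"
  have N: "e \<notin> edges F" "card e = 2" if "e \<in> N" for e using that by (auto simp: N_def complement_def)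
  obtain es where es: "distinct es" "set es = N"
    and sat': "\<forall>c. c \<in> N \<rightarrow> C \<and> inj_on c N \<longrightarrow> (\<forall>i<length es.
      \<exists>K. copy_of (path_graph l) (add_edges F (set (take (Suc i) es))) K \<and>
             rainbow (join_coloring F k c) K \<and> es ! i \<in> edges K)"
    using sat unfolding weakly_rainbow_saturated_def N_def by (elim exE conjE)
  have step: "\<exists>K. copy_of (path_graph l) (add_edges F (set (take (Suc i) es))) K \<and>
             rainbow (join_coloring F k c) K \<and> es ! i \<in> edges K"
    if "c ` N \<subseteq> C" "inj_on c N" "i < length es" for c i
  proof -
    have "c \<in> N \<rightarrow> C" using that(1) by auto
    then show ?thesis using sat' that(2,3) by blast
  qed
  have finN: "finite N" using es(2) by (metis List.finite_set)
  have "4 \<le> card N" unfolding N_def using four_le_card_nonedges[OF sF assms(2)] cF assms(5,6) by linarith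
  then have len: "4 \<le> length es" using es distinct_card by metis
  define e where "e = (!) es"
  have e: "e j \<in> N" "e j \<notin> edges F" "card (e j) = 2" if "j < 4" for j
    using N that len es(2) nth_mem[of j es] by (auto simp: e_def)
  have einj: "inj_on e {..<4}"
    using es(1) len by (auto simp: e_def inj_on_def nth_eq_iff_index_eq)
  \<comment> \<open>Any injective choice of colors for some of \<open>e 0\<close>, ...,
    \<open>e t\<close> extends to an injective coloring of all non-edges, and saturation answers
    with a rainbow path through \<open>e t\<close>.\<close>
  have copy: "\<exists>K x y c. K \<subseteq> edges F \<union> e ` {..t} \<and> e t \<in> K \<and> card K = l - 1 \<and> path_degrees K x y \<and>
      inj_on (join_coloring F k c) K \<and> (\<forall>j\<in>M. join_coloring F k c (e j) = c0 j)"
    if t: "t < 4" and M: "M \<subseteq> {..t}" "inj_on c0 M" "c0 ` M \<subseteq> C" for t M and c0 :: "nat \<Rightarrow> 'a"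
  proof -
    have Me: "inj_on e M" by (rule inj_on_subset[OF einj]) (use M t in auto)
    have inv: "inv_into M e (e j) = j" if "j \<in> M" for j using Me that by simp
    have M4: "j < 4" if "j \<in> M" for j using subsetD[OF M(1) that] t by simp
    have "e ` M \<subseteq> N" by (intro image_subsetI e(1) M4)
    moreover have "inj_on (c0 \<circ> inv_into M e) (e ` M)"
      using M(2) inv by (auto simp: inj_on_def)
    moreover have "(c0 \<circ> inv_into M e) ` e ` M \<subseteq> C"
      using M(3) inv by (simp add: image_subset_iff)
    ultimately obtain c where c: "inj_on c N" "c ` N \<subseteq> C"
      "\<And>x. x \<in> e ` M \<Longrightarrow> c x = (c0 \<circ> inv_into M e) x"
      using extend_injective_coloring[OF finN assms(1), of "e ` M" "c0 \<circ> inv_into M e"] by metis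
    have "t < length es" using t len by simp
    then obtain K where K: "copy_of (path_graph l) (add_edges F (set (take (Suc t) es))) K"
      "rainbow (join_coloring F k c) K" "es ! t \<in> edges K"
      using step[OF c(2,1)] by blast
    have "set (take (Suc t) es) = e ` {..t}"
    proof -
      have "set (take (Suc t) es) = (\<lambda>i. es ! i) ` {..<Suc t}"
        using \<open>t < length es\<close> nth_image[of "Suc t" es] by (simp add: lessThan_atLeast0)
      then show ?thesis by (simp add: e_def lessThan_Suc_atMost)
    qed
    then have "edges K \<subseteq> edges F \<union> e ` {..t}" using K(1) by (simp add: copy_of_def subgraph_def add_edges_def)
    moreover obtain x y where "card (edges K) = l - 1" "path_degrees (edges K) x y"
      using path_copy_degrees[OF K(1)] assms(5) by auto
    moreover have "join_coloring F k c (e j) = c0 j" if "j \<in> M" for j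
      using c(3)[of "e j"] inv[OF that] e(2)[OF M4[OF that]] that by (simp add: join_coloring_def)
    ultimately show ?thesis using K(2,3) unfolding rainbow_def e_def by blast
  qed
  have joinF: "join_coloring F k c h = k h" if "h \<in> edges F" for c h using that by (simp add: join_coloring_def)
  have kinj: "inj_on k K" if "inj_on (join_coloring F k c) K" "K \<subseteq> edges F" for K c
    using that joinF by (auto simp: inj_on_def subset_iff)
  \<comment> \<open>With \<open>M\<close> empty no color is prescribed, so any map will do. The path
    has more than one edge, so it contains an edge of \<open>F\<close>.\<close>
  obtain K0 where K0: "K0 \<subseteq> edges F \<union> e ` {..0}" "e 0 \<in> K0" "card K0 = l - 1"
    using copy[of 0 "{}" undefined] by auto
  have "\<not> K0 \<subseteq> {e 0}" using K0(3) assms(5) card_mono[of "{e 0}" K0] by auto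
  then obtain f where f: "f \<in> edges F" using K0(1) by auto
  \<comment> \<open>Giving \<open>e 0\<close> the color of \<open>f\<close> yields a rainbow path
    whose other \<open>l - 2\<close> edges lie in \<open>F\<close> and avoid that color. With
    \<open>f\<close> they form a rainbow set of \<open>l - 1\<close> edges.\<close>
  have "k f \<in> C" using kC f by auto
  then obtain K c where K: "K \<subseteq> edges F \<union> e ` {..0}" "e 0 \<in> K" "card K = l - 1"
    "inj_on (join_coloring F k c) K" "join_coloring F k c (e 0) = k f"
    using copy[of 0 "{0}" "\<lambda>_. k f"] by auto
  have KF: "K - {e 0} \<subseteq> edges F" using K(1) by auto
  define F0 where "F0 = insert f (K - {e 0})"
  have kf: "k f \<noteq> k h" if "h \<in> K - {e 0}" for h
    using inj_onD[OF K(4), of "e 0" h] K(2,5) joinF[of h c] that KF by auto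
  have kF0: "inj_on k F0"
  proof -
    have "inj_on k (K - {e 0})" by (rule kinj[OF inj_on_subset[OF K(4)] KF]) auto
    then show ?thesis unfolding F0_def using kf by (auto simp: inj_on_insert)
  qed
  have "finite K" using K(3) assms(5) card.infinite by fastforce
  then have cF0: "card F0 = l - 1"
    using K(2,3) kf assms(5) unfolding F0_def by (subst card_insert_disjoint) auto
  have F0F: "F0 \<subseteq> edges F" using KF f by (simp add: F0_def)
  show False
  proof (rule not_path_extending[OF tF cF F0F])
    show "l \<le> card F0 + 1" using cF0 by simp
    show "30 \<le> l" by (rule assms)
    show "e j \<notin> edges F \<and> card (e j) = 2" if "j < 4" for j using e that by simp
    show "inj_on e {..<4}" by (rule einj)
    show "path_extending l (edges F) F0 e t" if t: "t < 4" for t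
      unfolding path_extending_def
    proof (intro allI impI, elim conjE)
      fix f assume f: "inj_on f {..t}" "f ` {..t} \<subseteq> F0"
      have ff: "f j \<in> edges F" if "j \<le> t" for j using f F0F that by auto
      \<comment> \<open>Distinct edges of \<open>F0\<close> have distinct colors, so these can be
        prescribed on \<open>e 0\<close>, ..., \<open>e t\<close> simultaneously.\<close>
      have "inj_on (k \<circ> f) {..t}" by (rule comp_inj_on[OF f(1) inj_on_subset[OF kF0 f(2)]])
      moreover have "(k \<circ> f) ` {..t} \<subseteq> C" using ff kC by auto
      ultimately obtain K x y c where K: "K \<subseteq> edges F \<union> e ` {..t}" "e t \<in> K" "card K = l - 1"
        "path_degrees K x y" "inj_on (join_coloring F k c) K"
        "\<And>j. j \<le> t \<Longrightarrow> join_coloring F k c (e j) = k (f j)"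
        using copy[OF t, of "{..t}" "k \<circ> f"] by auto
      \<comment> \<open>\<open>e j\<close> and \<open>f j\<close> have the same color, so a rainbow
        path cannot contain both. As \<open>e t\<close> is on the path, the case
        \<open>j = t\<close> excludes \<open>f t\<close>.\<close>
      have no: "\<not> (e j \<in> K \<and> f j \<in> K)" if "j \<le> t" for j
        using inj_onD[OF K(5), of "e j" "f j"] K(6)[OF that] joinF[OF ff[OF that], of c]
          e(2)[of j] ff[OF that] that t by auto
      then show "\<exists>K x y. K \<subseteq> edges F \<union> e ` {..t} \<and> e t \<in> K \<and> card K = l - 1 \<and> path_degrees K x y \<and>
          f t \<notin> K \<and> (\<forall>j<t. \<not> (e j \<in> K \<and> f j \<in> K))"
        using K(1-4) no by (intro exI[of _ K] exI[of _ x] exI[of _ y]) (auto simp: less_imp_le)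
    qed
  qed
qed

subsection \<open>Upper bound\<close>

fun path_edges :: "'a list \<Rightarrow> 'a set set" where
  "path_edges (x # y # zs) = insert {x, y} (path_edges (y # zs))"
| "path_edges _ = {}"

lemma path_edges_append:
  "as \<noteq> [] \<Longrightarrow> bs \<noteq> [] \<Longrightarrow> path_edges (as @ bs) = path_edges as \<union> insert {last as, hd bs} (path_edges bs)"
proof (induction as rule: path_edges.induct)
  case ("2_2" x) then show ?case by (cases bs) auto
qed auto

lemma path_edges_append_subset: "path_edges as \<subseteq> path_edges (as @ bs)"
  by (cases "as = []"; cases "bs = []") (auto simp: path_edges_append)

lemma path_edges_take_subset: "path_edges (take n xs) \<subseteq> path_edges xs"
  using path_edges_append_subset[of "take n xs" "drop n xs"] by simp

lemma path_edges_rev: "path_edges (rev xs) = path_edges xs"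
proof (induction xs rule: path_edges.induct)
  case (1 x y zs)
  have "path_edges (rev (x # y # zs)) = path_edges (rev (y # zs) @ [x])" by simp
  also have "\<dots> = path_edges (y # zs) \<union> {{y, x}}"
    using 1 by (subst path_edges_append) (auto simp: last_rev)
  finally show ?case by (auto simp: insert_commute)
qed auto

lemma path_edges_subset: "e \<in> path_edges xs \<Longrightarrow> e \<subseteq> set xs"
  by (induction xs rule: path_edges.induct) auto

lemma path_edges_split:
  "e \<in> path_edges xs \<Longrightarrow> \<exists>as bs. xs = as @ bs \<and> as \<noteq> [] \<and> bs \<noteq> [] \<and> e = {last as, hd bs}"
proof (induction xs rule: path_edges.induct)
  case (1 x y zs)
  then consider "e = {x, y}" | "e \<in> path_edges (y # zs)" by auto
  then show ?case
  proof cases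
    case 1 then show ?thesis by (intro exI[of _ "[x]"] exI[of _ "y # zs"]) auto
  next
    case 2
    then obtain as bs where "y # zs = as @ bs" "as \<noteq> []" "bs \<noteq> []" "e = {last as, hd bs}" using 1 by blast
    then show ?thesis by (intro exI[of _ "x # as"] exI[of _ bs]) auto
  qed
qed auto

lemma path_edges_conv_nth: "path_edges xs = {{xs ! i, xs ! Suc i} | i. Suc i < length xs}"
proof (induction xs rule: path_edges.induct)
  case (1 x y zs)
  have "{{(x # y # zs) ! i, (x # y # zs) ! Suc i} | i. Suc i < length (x # y # zs)}
      = insert {x, y} {{(y # zs) ! i, (y # zs) ! Suc i} | i. Suc i < length (y # zs)}" (is "?A = ?B")
  proof
    show "?A \<subseteq> ?B"
    proof
      fix e assume "e \<in> ?A"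
      then obtain i where i: "e = {(x # y # zs) ! i, (x # y # zs) ! Suc i}" "Suc i < length (x # y # zs)" by blast
      then show "e \<in> ?B" by (cases i) auto
    qed
    have "{(y # zs) ! i, (y # zs) ! Suc i} \<in> ?A" if "Suc i < length (y # zs)" for i
      using that by (intro CollectI exI[of _ "Suc i"]) auto
    moreover have "{x, y} \<in> ?A" by (intro CollectI exI[of _ 0]) auto
    ultimately show "?B \<subseteq> ?A" by blast
  qed
  then show ?case using 1 by simp
qed auto

text \<open>Indexing into the list is the isomorphism from \<open>path_graph\<close>; distinctness
  makes every consecutive pair a set of size two.\<close>

lemma copy_of_path_list:
  assumes "distinct xs" "set xs \<subseteq> verts G" "path_edges xs \<subseteq> edges G" "finite (verts G)"
  shows "copy_of (path_graph (length xs)) G \<lparr>verts = set xs, edges = path_edges xs\<rparr>"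
proof -
  have "card e = 2" if e: "e \<in> path_edges xs" for e
  proof -
    obtain as bs where ab: "xs = as @ bs" "as \<noteq> []" "bs \<noteq> []" "e = {last as, hd bs}"
      using path_edges_split[OF e] by blast
    then have "last as \<noteq> hd bs" using assms(1) by (metis disjoint_iff distinct_append hd_in_set last_in_set)
    then show ?thesis using ab by simp
  qed
  then have "simple_graph \<lparr>verts = set xs, edges = path_edges xs\<rparr>"
    using path_edges_subset by (auto simp: simple_graph_def)
  moreover have "bij_betw ((!) xs) {..<length xs} (set xs)" using assms(1) by (rule bij_betw_nth) auto
  moreover have "path_edges xs = (\<lambda>e. (!) xs ` e) ` {{i, Suc i} | i. Suc i < length xs}"
    unfolding path_edges_conv_nth by (auto simp: image_iff) (metis image_empty image_insert)+
  ultimately show ?thesis using assms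
    by (auto simp: copy_of_def subgraph_def isomorphic_def path_graph_def)
qed

section \<open>Adding edges one at a time\<close>

text \<open>One step of the saturation process, relative to the set \<open>S\<close> of edges
  already added instead of a position in an ordering. In this form it is monotone in
  \<open>S\<close>.\<close>

definition addable :: "'c set \<Rightarrow> 'b graph \<Rightarrow> 'a graph \<Rightarrow> ('a set \<Rightarrow> 'c) \<Rightarrow> 'a set set \<Rightarrow> 'a set \<Rightarrow> bool" where
  "addable C H F k S e \<longleftrightarrow>
     (\<forall>c. c \<in> edges (complement F) \<rightarrow> C \<and> inj_on c (edges (complement F)) \<longrightarrow>
       (\<exists>K. copy_of H (add_edges F (insert e S)) K \<and> rainbow (join_coloring F k c) K \<and> e \<in> edges K))"

lemma addable_mono: "addable C H F k S e \<Longrightarrow> S \<subseteq> T \<Longrightarrow> addable C H F k T e"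
proof -
  assume a: "addable C H F k S e" and ST: "S \<subseteq> T"
  have "copy_of H (add_edges F (insert e T)) K" if "copy_of H (add_edges F (insert e S)) K" for K
    using that ST by (auto simp: copy_of_def subgraph_def add_edges_def)
  then show ?thesis using a unfolding addable_def by meson
qed

definition reachable :: "'c set \<Rightarrow> 'b graph \<Rightarrow> 'a graph \<Rightarrow> ('a set \<Rightarrow> 'c) \<Rightarrow> 'a set set \<Rightarrow> bool" where
  "reachable C H F k S \<longleftrightarrow>
     (\<exists>es. distinct es \<and> set es = S \<and> (\<forall>i<length es. addable C H F k (set (take i es)) (es ! i)))"

lemma reachable_empty: "reachable C H F k {}"
  unfolding reachable_def by (intro exI[of _ "[]"]) auto

text \<open>An edge addable over \<open>S\<close> stays addable after other edges have been
  inserted, so the edges of \<open>T\<close> can be appended in any order.\<close>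

lemma reachable_Un:
  assumes "reachable C H F k S" "finite T" "\<And>e. e \<in> T - S \<Longrightarrow> addable C H F k S e"
  shows "reachable C H F k (S \<union> T)"
  using assms(2,3)
proof (induction T rule: finite_induct)
  case empty then show ?case using assms(1) by simp
next
  case (insert e T)
  then have IH: "reachable C H F k (S \<union> T)" by blast
  show ?case
  proof (cases "e \<in> S")
    case True then show ?thesis using IH by (simp add: insert_absorb)
  next
    case False
    obtain es where es: "distinct es" "set es = S \<union> T"
      "\<And>i. i < length es \<Longrightarrow> addable C H F k (set (take i es)) (es ! i)"
      using IH by (auto simp: reachable_def)
    have "addable C H F k (S \<union> T) e" using insert.prems[of e] False addable_mono by blast
    then have "addable C H F k (set (take i (es @ [e]))) ((es @ [e]) ! i)" if "i < length (es @ [e])" for i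
      using es that by (cases "i < length es") (auto simp: nth_append less_Suc_eq)
    then show ?thesis unfolding reachable_def using es False insert.hyps
      by (intro exI[of _ "es @ [e]"]) auto
  qed
qed

lemma weakly_rainbow_saturated_if_reachable:
  assumes "reachable C H F k (edges (complement F))"
  shows "weakly_rainbow_saturated C H F k"
proof -
  obtain es where es: "distinct es" "set es = edges (complement F)"
      "\<And>i. i < length es \<Longrightarrow> addable C H F k (set (take i es)) (es ! i)"
      using assms by (auto simp: reachable_def)
  have "insert (es ! i) (set (take i es)) = set (take (Suc i) es)" if "i < length es" for i
    using that by (simp add: take_Suc_conv_app_nth)
  then have "\<forall>c. c \<in> edges (complement F) \<rightarrow> C \<and> inj_on c (edges (complement F)) \<longrightarrow>
      (\<forall>i<length es. \<exists>K. copy_of H (add_edges F (set (take (Suc i) es))) K \<and>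
        rainbow (join_coloring F k c) K \<and> es ! i \<in> edges K)"
    using es(3) unfolding addable_def by simp
  then show ?thesis using es(1,2) unfolding weakly_rainbow_saturated_def by blast
qed

text \<open>A path made of non-edges of \<open>F\<close> is colored by \<open>c\<close> alone, hence
  rainbow for every injective \<open>c\<close>. A longer path is cut to its first \<open>l\<close>
  vertices, and \<open>Suc i < l\<close> keeps \<open>e\<close> on it.\<close>

lemma addable_by_path:
  assumes fin: "finite (verts F)" and S: "S \<subseteq> edges (complement F)" "e \<in> edges (complement F)"
    and xs: "distinct xs" "set xs \<subseteq> verts F" "path_edges xs \<subseteq> insert e S" "l \<le> length xs"
    and i: "e = {xs ! i, xs ! Suc i}" "Suc i < l"
  shows "addable C (path_graph l) F k S e"
  unfolding addable_def
proof (intro allI impI)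
  fix c assume c: "c \<in> edges (complement F) \<rightarrow> C \<and> inj_on c (edges (complement F))"
  let ?ys = "take l xs"
  have sub: "path_edges ?ys \<subseteq> insert e S" using xs(3) path_edges_take_subset by blast
  have len: "length ?ys = l" using xs(4) by simp
  have "copy_of (path_graph (length ?ys)) (add_edges F (insert e S)) \<lparr>verts = set ?ys, edges = path_edges ?ys\<rparr>"
    by (rule copy_of_path_list) (use xs(1,2) sub fin set_take_subset[of l xs] in \<open>auto simp: add_edges_def\<close>)
  moreover have "inj_on (join_coloring F k c) (path_edges ?ys)"
  proof -
    have sub': "path_edges ?ys \<subseteq> edges (complement F)" using sub S by blast
    have "join_coloring F k c h = c h" if "h \<in> path_edges ?ys" for h
      using sub' that by (auto simp: join_coloring_def complement_def)
    then show ?thesis using c sub' by (metis inj_on_cong inj_on_subset)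
  qed
  moreover have "e \<in> path_edges ?ys" using i len unfolding path_edges_conv_nth by (intro CollectI exI[of _ i]) simp
  ultimately show "\<exists>K. copy_of (path_graph l) (add_edges F (insert e S)) K \<and>
      rainbow (join_coloring F k c) K \<and> e \<in> edges K"
    using len by (intro exI[of _ "\<lparr>verts = set ?ys, edges = path_edges ?ys\<rparr>"]) (simp add: rainbow_def)
qed

section \<open>Cycles as vertex lists\<close>

text \<open>The cycle is written as a path, cut open at the edge from the last vertex to the first;
  \<open>cycle_in_swap\<close> moves the cut.\<close>

definition cycle_in :: "'a set set \<Rightarrow> 'a list \<Rightarrow> bool" where
  "cycle_in S ys \<longleftrightarrow> distinct ys \<and> ys \<noteq> [] \<and> path_edges ys \<subseteq> S \<and> {last ys, hd ys} \<in> S"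

lemma cycle_in_mono: "cycle_in S ys \<Longrightarrow> S \<subseteq> T \<Longrightarrow> cycle_in T ys"
  by (auto simp: cycle_in_def)

lemma cycle_in_swap:
  assumes "cycle_in S (as @ bs)"
  shows "cycle_in S (bs @ as)"
proof (cases "as = [] \<or> bs = []")
  case False
  then show ?thesis using assms by (auto simp: cycle_in_def path_edges_append)
qed (use assms in auto)

lemma cycle_in_rotate_to:
  assumes "cycle_in S ys" "x \<in> set ys"
  obtains zs where "cycle_in S (x # zs)" "set (x # zs) = set ys" "length (x # zs) = length ys"
proof -
  obtain as bs where ys: "ys = as @ x # bs" using split_list[OF assms(2)] by blast
  then have "cycle_in S (x # (bs @ as))" using cycle_in_swap[of S as "x # bs"] assms(1) by simp
  then show ?thesis by (rule that) (auto simp: ys)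
qed

text \<open>Opening the cycle at \<open>f\<close> leaves a path through all its vertices, and
  \<open>e\<close> survives because it differs from \<open>f\<close>. If \<open>f\<close> is not on
  the cycle, it can be opened at any edge other than \<open>e\<close>.\<close>

lemma cycle_delete_edge:
  assumes "cycle_in S ys" "e = {last ys, hd ys}" "f \<noteq> e" "2 \<le> length ys"
  obtains xs where "distinct xs" "set xs = set ys" "length xs = length ys"
    "path_edges xs \<subseteq> S - {f}" "e \<in> path_edges xs"
proof -
  note result = that
  \<comment> \<open>Swapping the two parts puts \<open>e\<close> at the seam and drops the edge that
    joined \<open>as\<close> to \<open>bs\<close>.\<close>
  have *: thesis if ab: "ys = as @ bs" "as \<noteq> []" "bs \<noteq> []" "f \<notin> path_edges as" "f \<notin> path_edges bs" for as bs
  proof (rule result[of "bs @ as"])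
    have e: "e = {last bs, hd as}" using ab assms(2) by simp
    have "path_edges as \<subseteq> S" "path_edges bs \<subseteq> S" "e \<in> S"
      using assms(1,2) ab by (auto simp: cycle_in_def path_edges_append)
    then show "path_edges (bs @ as) \<subseteq> S - {f}" "e \<in> path_edges (bs @ as)"
      using ab(4,5) e assms(3) path_edges_append[OF ab(3,2)] by auto
  qed (use assms(1) ab in \<open>auto simp: cycle_in_def\<close>)
  show ?thesis
  proof (cases "f \<in> path_edges ys")
    case True
    then obtain as bs where ab: "ys = as @ bs" "as \<noteq> []" "bs \<noteq> []" "f = {last as, hd bs}"
      using path_edges_split by blast
    have "hd bs \<notin> set as" "last as \<notin> set bs"
      using assms(1) ab by (auto simp: cycle_in_def dest: hd_in_set last_in_set)
    then have "f \<notin> path_edges as" "f \<notin> path_edges bs"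
      using ab(4) path_edges_subset[of f as] path_edges_subset[of f bs] by auto
    then show ?thesis by (rule *[OF ab(1-3)])
  next
    case False
    obtain x zs where ys: "ys = x # zs" "zs \<noteq> []" using assms(4) by (cases ys; cases "tl ys") auto
    then have "path_edges ys = path_edges [x] \<union> insert {x, hd zs} (path_edges zs)"
      using path_edges_append[of "[x]" zs] by simp
    then have "f \<notin> path_edges [x]" "f \<notin> path_edges zs" using False by auto
    then show ?thesis using ys by (intro *[of "[x]" zs]) auto
  qed
qed

text \<open>Let the cycle be \<open>x\<close>, \<open>a\<close>, \<open>as'\<close>,
  \<open>y\<close>, \<open>bs\<close> in this order. The path starts after \<open>a\<close>, runs
  through \<open>as'\<close> to \<open>y\<close>, takes the chord to \<open>x\<close> and goes
  backwards through \<open>bs\<close>. It misses only the vertex \<open>a\<close>, so a cycle on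
  \<open>l + 1\<close> vertices gives a path on \<open>l\<close>.\<close>

lemma cycle_chord_path:
  assumes "cycle_in S ys" "x \<in> set ys" "y \<in> set ys" "x \<noteq> y" "{x, y} \<notin> S"
  obtains xs i where "distinct xs" "set xs \<subseteq> set ys" "Suc (length xs) = length ys"
    "path_edges xs \<subseteq> insert {x, y} S" "{x, y} = {xs ! i, xs ! Suc i}" "Suc i < length xs"
proof -
  obtain zs where zs: "cycle_in S (x # zs)" "set (x # zs) = set ys" "length (x # zs) = length ys"
    using cycle_in_rotate_to[OF assms(1,2)] by metis
  then have "y \<in> set zs" using assms(3,4) by auto
  then obtain as bs where ab: "zs = as @ y # bs" by (meson split_list)
  have "as \<noteq> []" using zs(1) assms(5) ab by (auto simp: cycle_in_def)
  have "bs \<noteq> []" using zs(1) assms(5) ab by (auto simp: cycle_in_def insert_commute)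
  obtain a as' where as: "as = a # as'" using \<open>as \<noteq> []\<close> by (cases as) auto
  let ?xs = "(as' @ [y]) @ (x # rev bs)"
  have p: "path_edges ((as @ [y]) @ bs) \<subseteq> S" "{last bs, x} \<in> S"
    using zs(1) ab \<open>bs \<noteq> []\<close> path_edges_append[of "[x]" zs] by (auto simp: cycle_in_def)
  have q: "path_edges (as' @ [y]) \<subseteq> S" "path_edges bs \<subseteq> S"
    using p(1) \<open>bs \<noteq> []\<close> path_edges_append[of "as @ [y]" bs] path_edges_append[of "[a]" "as' @ [y]"]
    by (auto simp: as)
  have "path_edges (x # rev bs) \<subseteq> S"
    using path_edges_append[of "[x]" "rev bs"] \<open>bs \<noteq> []\<close> q(2) p(2)
    by (simp add: path_edges_rev hd_rev insert_commute)
  moreover have "path_edges ?xs = path_edges (as' @ [y]) \<union> insert {y, x} (path_edges (x # rev bs))"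
    using path_edges_append[of "as' @ [y]" "x # rev bs"] by simp
  ultimately have "path_edges ?xs \<subseteq> insert {x, y} S"
    using q(1) by (simp add: insert_commute subset_insertI2)
  moreover have "distinct ?xs" "set ?xs \<subseteq> set ys" "Suc (length ?xs) = length ys"
    using zs ab as by (auto simp: cycle_in_def)
  moreover have "{x, y} = {?xs ! length as', ?xs ! Suc (length as')}"
    by (auto simp: nth_append)
  moreover have "Suc (length as') < length ?xs" by simp
  ultimately show ?thesis by (intro that[of ?xs "length as'"]) assumption+
qed

section \<open>A cycle and the chords skipping one vertex\<close>

text \<open>For \<open>m \<le> n\<close> the vertices from \<open>m\<close> to \<open>n - 1\<close>
  are isolated.\<close>

definition cycle_on :: "nat \<Rightarrow> nat \<Rightarrow> nat graph" where
  "cycle_on n m = \<lparr>verts = {..<n}, edges = (\<lambda>i. {i, Suc i mod m}) ` {..<m}\<rparr>"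

lemma edges_cycle_on: "edges (cycle_on n m) = (\<lambda>i. {i, Suc i mod m}) ` {..<m}"
  and verts_cycle_on: "verts (cycle_on n m) = {..<n}"
  by (simp_all add: cycle_on_def)

lemma mem_edges_cycle_on:
  assumes "a < b" "3 \<le> m"
  shows "{a, b} \<in> edges (cycle_on n m) \<longleftrightarrow> b < m \<and> (b = Suc a \<or> a = 0 \<and> Suc b = m)"
proof
  assume "{a, b} \<in> edges (cycle_on n m)"
  then obtain i where "i < m" "{a, b} = {i, Suc i mod m}" by (auto simp: edges_cycle_on)
  then show "b < m \<and> (b = Suc a \<or> a = 0 \<and> Suc b = m)"
    using assms by (auto simp: mod_Suc doubleton_eq_iff split: if_splits)
next
  assume r: "b < m \<and> (b = Suc a \<or> a = 0 \<and> Suc b = m)"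
  then consider "b = Suc a" | "a = 0" "Suc b = m" by blast
  then show "{a, b} \<in> edges (cycle_on n m)"
  proof cases
    case 1 then show ?thesis using r by (auto simp: edges_cycle_on intro!: image_eqI[of _ _ a])
  next
    case 2 then show ?thesis by (auto simp: edges_cycle_on intro!: image_eqI[of _ _ b])
  qed
qed

lemma card_edges_cycle_on:
  assumes "3 \<le> m"
  shows "card (edges (cycle_on n m)) = m"
proof -
  have "inj_on (\<lambda>i. {i, Suc i mod m}) {..<m}"
    using assms by (auto intro!: inj_onI simp: mod_Suc doubleton_eq_iff split: if_splits)
  then show ?thesis by (simp add: edges_cycle_on card_image)
qed

lemma simple_cycle_on: "3 \<le> m \<Longrightarrow> m \<le> n \<Longrightarrow> simple_graph (cycle_on n m)"
proof -
  assume m: "3 \<le> m" "m \<le> n"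
  have "{i, Suc i mod m} \<subseteq> {..<n} \<and> card {i, Suc i mod m} = 2" if "i < m" for i
  proof -
    have "Suc i mod m < n" using mod_less_divisor[of m "Suc i"] m by linarith
    moreover have "i \<noteq> Suc i mod m" using m that by (auto simp: mod_Suc)
    ultimately show ?thesis using m that by simp
  qed
  then show ?thesis by (simp add: simple_graph_def edges_cycle_on verts_cycle_on)
qed

lemma mem_complement_cycle_on:
  assumes "a < b" "b < n" "3 \<le> m"
  shows "{a, b} \<in> edges (complement (cycle_on n m)) \<longleftrightarrow> \<not> (b < m \<and> (b = Suc a \<or> a = 0 \<and> Suc b = m))"
proof -
  have "{a, b} \<subseteq> {..<n} \<and> card {a, b} = 2" using assms by simp
  then show ?thesis using mem_edges_cycle_on[OF assms(1,3), of n] by (simp add: complement_def verts_cycle_on)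
qed

lemma add_mod_range:
  fixes i d m :: nat
  assumes "i < m" "d \<le> m"
  shows "(i + d) mod m = (if i + d < m then i + d else i + d - m)"
  using assms by (simp add: mod_if)

lemma mod_add_left_inj:
  fixes p a b m :: nat
  assumes "(p + a) mod m = (p + b) mod m" "a < m" "b < m"
  shows "a = b"
  using assms
proof (induction a b rule: linorder_wlog)
  case (le a b)
  then have "m dvd (p + b) - (p + a)" by (subst mod_eq_dvd_iff_nat[symmetric]) auto
  then have "m dvd b - a" by simp
  then show ?case using le by (auto dest: dvd_imp_le)
qed simp

text \<open>For \<open>5 \<le> m\<close> each of these chords bypasses one vertex of the cycle and
  closes a cycle on the other \<open>m - 1\<close>.\<close>

definition skips :: "nat \<Rightarrow> nat set set" where
  "skips m = (\<lambda>i. {i, (i + 2) mod m}) ` {..<m}"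

lemma skipsI: "i < m \<Longrightarrow> j = (i + 2) mod m \<Longrightarrow> {i, j} \<in> skips m"
  by (auto simp: skips_def)

lemma skips_subset:
  assumes "5 \<le> m" "m \<le> n"
  shows "skips m \<subseteq> edges (complement (cycle_on n m))"
proof
  fix e assume "e \<in> skips m"
  then obtain i where i: "i < m" "e = {i, (i + 2) mod m}" by (auto simp: skips_def)
  show "e \<in> edges (complement (cycle_on n m))"
  proof (cases "i + 2 < m")
    case True
    then show ?thesis using i mem_complement_cycle_on[of i "i + 2" n m] assms by (cases i) auto
  next
    case False
    then have "(i + 2) mod m = i + 2 - m" using i assms add_mod_range[of i m 2] by simp
    then show ?thesis using i False mem_complement_cycle_on[of "i + 2 - m" i n m] assms
      by (simp add: insert_commute)
  qed
qed

text \<open>The chord closes a cycle on \<open>m - 1\<close> vertices. As \<open>k\<close> is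
  injective, at most one original edge has the color of \<open>e\<close>; deleting that edge leaves
  a rainbow path on the same vertices through \<open>e\<close>.\<close>

lemma addable_skip:
  assumes m: "5 \<le> m" "m \<le> n" and e: "e \<in> skips m" and k: "inj_on k (edges (cycle_on n m))"
  shows "addable C (path_graph (m - 1)) (cycle_on n m) k {} e"
  unfolding addable_def
proof (intro allI impI)
  let ?F = "cycle_on n m"
  fix c assume "c \<in> edges (complement ?F) \<rightarrow> C \<and> inj_on c (edges (complement ?F))"
  obtain i where i: "i < m" "e = {i, (i + 2) mod m}" using e by (auto simp: skips_def)
  have eF: "e \<notin> edges ?F" using skips_subset[OF m] e by (auto simp: complement_def)
  \<comment> \<open>The long way round modulo \<open>m\<close>, from \<open>i + 2\<close> to
    \<open>i + m\<close>, which is \<open>i\<close> again; only \<open>i + 1\<close> is left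
    out.\<close>
  define ys where "ys = map (\<lambda>j. (i + 2 + j) mod m) [0..<m - 1]"
  have len: "length ys = m - 1" and two: "2 \<le> length ys" using m by (auto simp: ys_def)
  have "last ys = (i + 2 + (m - 2)) mod m" using m by (simp add: ys_def last_map last_upt numeral_2_eq_2)
  also have "i + 2 + (m - 2) = i + m" using m by simp
  also have "(i + m) mod m = i" using i by simp
  finally have last_hd: "last ys = i" "hd ys = (i + 2) mod m" using m by (simp_all add: ys_def hd_map)
  have "cycle_in (insert e (edges ?F)) ys"
    unfolding cycle_in_def
  proof (intro conjI)
    have "inj_on (\<lambda>j. (i + 2 + j) mod m) {0..<m - 1}"
    proof (rule inj_onI)
      fix a b assume ab: "a \<in> {0..<m - 1}" "b \<in> {0..<m - 1}" "(i + 2 + a) mod m = (i + 2 + b) mod m"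
      then show "a = b" by (intro mod_add_left_inj[of "i + 2" a m b]) auto
    qed
    then show "distinct ys" by (simp add: ys_def distinct_map)
    show "ys \<noteq> []" using len m by auto
    show "path_edges ys \<subseteq> insert e (edges ?F)"
    proof
      fix h assume "h \<in> path_edges ys"
      then obtain j where "Suc j < m - 1" "h = {(i + 2 + j) mod m, (i + 2 + Suc j) mod m}"
        by (auto simp: path_edges_conv_nth ys_def)
      moreover have "(i + 2 + Suc j) mod m = Suc ((i + 2 + j) mod m) mod m" for j
        by (simp add: mod_Suc_eq)
      ultimately show "h \<in> insert e (edges ?F)" using m unfolding edges_cycle_on by auto
    qed
    show "{last ys, hd ys} \<in> insert e (edges ?F)" using last_hd i by simp
  qed
  then have cyc: "cycle_in (insert e (edges ?F)) ys" "e = {last ys, hd ys}" using last_hd i by auto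
  \<comment> \<open>\<open>f\<close> is the one original edge that may share its color with
    \<open>e\<close>. If there is none, the empty set stands in for it: it is no edge, so deleting
    it does no harm.\<close>
  obtain f where f: "f \<noteq> e" "\<And>h. h \<in> edges ?F \<Longrightarrow> k h = c e \<Longrightarrow> h = f"
  proof (cases "\<exists>h\<in>edges ?F. k h = c e")
    case True
    then obtain h where "h \<in> edges ?F" "k h = c e" by blast
    then show ?thesis using that[of h] eF inj_onD[OF k] by metis
  next
    case False
    then show ?thesis using that[of "{}"] i by blast
  qed
  obtain xs where xs: "distinct xs" "set xs = set ys" "length xs = length ys"
    "path_edges xs \<subseteq> insert e (edges ?F) - {f}" "e \<in> path_edges xs"
    using cycle_delete_edge[OF cyc f(1)] two by blast
  have "set xs \<subseteq> {..<n}"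
  proof -
    have "(i + 2 + j) mod m < n" for j using mod_less_divisor[of m "i + 2 + j"] m by linarith
    then show ?thesis using xs(2) by (auto simp: ys_def)
  qed
  then have "copy_of (path_graph (length xs)) (add_edges ?F {e}) \<lparr>verts = set xs, edges = path_edges xs\<rparr>"
    using xs(1,4) by (intro copy_of_path_list) (auto simp: add_edges_def verts_cycle_on)
  moreover have "inj_on (join_coloring ?F k c) (path_edges xs)"
  proof (rule inj_onI)
    fix g h assume gh: "g \<in> path_edges xs" "h \<in> path_edges xs"
      "join_coloring ?F k c g = join_coloring ?F k c h"
    then have "g = e \<or> g \<in> edges ?F \<and> g \<noteq> f" "h = e \<or> h \<in> edges ?F \<and> h \<noteq> f" using xs(4) by auto
    then show "g = h" using gh(3) f(2)[of g] f(2)[of h] eF inj_onD[OF k, of g h]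
      by (auto simp: join_coloring_def)
  qed
  ultimately show "\<exists>K. copy_of (path_graph (m - 1)) (add_edges ?F {e}) K \<and>
      rainbow (join_coloring ?F k c) K \<and> e \<in> edges K"
    using xs(3,5) len
    by (intro exI[of _ "\<lparr>verts = set xs, edges = path_edges xs\<rparr>"]) (simp add: rainbow_def)
qed

section \<open>Saturation of the rainbow cycle\<close>

text \<open>For odd \<open>m\<close> doubling is a bijection modulo \<open>m\<close>, so the
  skipping chords already contain a cycle through all \<open>m\<close> vertices. For even
  \<open>m\<close> they form one cycle on the even and one on the odd vertices, and two more chords
  join these.\<close>

lemma reachable_hamiltonian_cycle:
  assumes m: "31 \<le> m" "m \<le> n" and k: "inj_on k (edges (cycle_on n m))"
  obtains S ys where "S \<subseteq> edges (complement (cycle_on n m))"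
    "reachable C (path_graph (m - 1)) (cycle_on n m) k S"
    "cycle_in S ys" "set ys = {..<m}" "length ys = m"
proof -
  let ?N = "edges (complement (cycle_on n m))"
  have m5: "5 \<le> m" using m by simp
  have skN: "skips m \<subseteq> ?N" by (rule skips_subset[OF m5 m(2)])
  have "reachable C (path_graph (m - 1)) (cycle_on n m) k ({} \<union> skips m)"
    by (rule reachable_Un[OF reachable_empty]) (use addable_skip[OF m5 m(2) _ k] in \<open>auto simp: skips_def\<close>)
  then have reach: "reachable C (path_graph (m - 1)) (cycle_on n m) k (skips m)" by simp
  show ?thesis
  proof (cases "odd m")
    case True
    define ys where "ys = map (\<lambda>i. 2 * i mod m) [0..<m]"
    have "inj_on (\<lambda>i. 2 * i mod m) {0..<m}"
    proof (rule inj_onI)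
      fix a b assume "a \<in> {0..<m}" "b \<in> {0..<m}" "2 * a mod m = 2 * b mod m"
      then show "a = b"
      proof (induction a b rule: linorder_wlog)
        case (le a b)
        then have "m dvd 2 * b - 2 * a" by (subst mod_eq_dvd_iff_nat[symmetric]) auto
        then have "m dvd 2 * (b - a)" by (simp add: right_diff_distrib')
        then have "m dvd b - a" using True by (subst (asm) coprime_dvd_mult_right_iff) auto
        then show ?case using le by (auto dest: dvd_imp_le)
      qed simp
    qed
    then have d: "distinct ys" by (simp add: ys_def distinct_map)
    have len: "length ys = m" by (simp add: ys_def)
    have sub: "set ys \<subseteq> {..<m}" using m by (auto simp: ys_def)
    then have "set ys = {..<m}" using card_subset_eq[OF _ sub] distinct_card[OF d] len by simp
    moreover have "cycle_in (skips m) ys"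
      unfolding cycle_in_def
    proof (intro conjI d)
      show "ys \<noteq> []" using len m by auto
      show "path_edges ys \<subseteq> skips m"
      proof
        fix h assume "h \<in> path_edges ys"
        then obtain j where "Suc j < m" "h = {2 * j mod m, 2 * Suc j mod m}"
          by (auto simp: path_edges_conv_nth ys_def)
        moreover have "2 * Suc j mod m = (2 * j mod m + 2) mod m" for j using mod_add_left_eq[of "2 * j" m 2] by simp
        ultimately show "h \<in> skips m" using m by (auto intro!: skipsI)
      qed
      have "2 * (m - 1) = m + (m - 2)" using m by simp
      then have "2 * (m - 1) mod m = (m - 2) mod m" by simp
      then have "last ys = m - 2" using m by (simp add: ys_def last_map last_upt)
      moreover have "hd ys = 0" using m by (simp add: ys_def hd_map)
      moreover have "m - 2 + 2 = m" using m by simp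
      then have "{m - 2, 0} \<in> skips m" using m by (intro skipsI) simp_all
      ultimately show "{last ys, hd ys} \<in> skips m" by simp
    qed
    ultimately show ?thesis using that[OF skN reach] len by blast
  next
    case False
    then obtain h where h: "m = 2 * h" by (auto elim: evenE)
    \<comment> \<open>The even vertices run from 0 to \<open>m - 2\<close>, the odd ones from 7 to
      \<open>m - 1\<close> and then through 1, 3, 5. Opening the odd cycle between 5 and 7 makes
      both connecting chords, \<open>{m - 2, 7}\<close> and \<open>{5, 0}\<close>, non-edges of the
      original cycle.\<close>
    define as where "as = map (\<lambda>i. 2 * i) [0..<h]"
    define b1 where "b1 = map (\<lambda>i. 2 * i + 1) [3..<h]"
    define b2 where "b2 = map (\<lambda>i. 2 * i + 1) [0..<3]"
    define bs where "bs = b1 @ b2"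
    have h16: "16 \<le> h" using h m by simp
    have skI: "{i, i + 2} \<in> skips m" if "i + 2 < m" for i using that by (auto intro!: skipsI)
    have ev: "path_edges (map (\<lambda>i. 2 * i + r) [p..<q]) \<subseteq> skips m" if "2 * (q - 1) + r < m" for p q r
    proof
      fix g assume "g \<in> path_edges (map (\<lambda>i. 2 * i + r) [p..<q])"
      then obtain j where "Suc j < q - p" "g = {2 * (p + j) + r, 2 * (p + j) + r + 2}"
        by (auto simp: path_edges_conv_nth)
      then show "g \<in> skips m" using skI[of "2 * (p + j) + r"] that by simp
    qed
    have ne: "as \<noteq> []" "bs \<noteq> []" "b1 \<noteq> []" "b2 \<noteq> []"
      using h16 by (auto simp: as_def bs_def b1_def b2_def)
    have ends: "hd as = 0" "last as = m - 2" "hd bs = 7" "last bs = 5"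
      using h16 h by (auto simp: as_def bs_def b1_def b2_def hd_map last_map hd_append numeral_eq_Suc)
    have pa: "path_edges as \<subseteq> skips m" using ev[of h 0 0] h h16 by (simp add: as_def)
    have pb: "path_edges bs \<subseteq> skips m"
    proof -
      have "path_edges b1 \<subseteq> skips m" "path_edges b2 \<subseteq> skips m"
        using ev[of h 1 3] ev[of 3 1 0] h h16 by (simp_all add: b1_def b2_def)
      moreover have "{m - 1, 1} \<in> skips m" using h16 h by (intro skipsI) (auto simp: mod_if)
      moreover have "last b1 = m - 1" "hd b2 = 1" using h16 h by (auto simp: b1_def b2_def last_map hd_map)
      ultimately show ?thesis unfolding bs_def using path_edges_append[OF ne(3,4)] by simp
    qed
    have sets: "set as = {i. i < m \<and> even i}" "set bs = {i. i < m \<and> odd i}"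
    proof -
      show "set as = {i. i < m \<and> even i}" by (auto simp: as_def h elim!: evenE)
      have "set bs = (\<lambda>i. 2 * i + 1) ` {0..<h}"
        unfolding bs_def b1_def b2_def using h16 by (auto simp: image_iff)
      then show "set bs = {i. i < m \<and> odd i}" by (auto simp: h elim!: oddE)
    qed
    have "inj_on (\<lambda>i. 2 * i + r) A" for r :: nat and A by (auto simp: inj_on_def)
    then have d: "distinct as" "distinct bs"
      by (auto simp: as_def bs_def b1_def b2_def distinct_map inj_on_def)
    have dab: "distinct (as @ bs)" "distinct (bs @ as)" "set (as @ bs) = {..<m}" "set (bs @ as) = {..<m}"
      using d sets by auto
    have len: "length as = h" "length bs = h" using h16 by (auto simp: as_def bs_def b1_def b2_def)
    let ?c1 = "{m - 2, 7}" and ?c2 = "{5, 0::nat}"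
    have cN: "?c1 \<in> ?N" "?c2 \<in> ?N"
      using mem_complement_cycle_on[of 7 "m - 2" n m] mem_complement_cycle_on[of 0 5 n m] m
      by (auto simp: insert_commute)
    \<comment> \<open>Either connecting chord alone completes a path of added edges through all
      \<open>m\<close> vertices, so each is addable directly over \<open>skips m\<close>.\<close>
    have p1: "path_edges (as @ bs) \<subseteq> insert ?c1 (skips m)"
      using path_edges_append[OF ne(1,2)] pa pb ends by auto
    have p2: "path_edges (bs @ as) \<subseteq> insert ?c2 (skips m)"
      using path_edges_append[OF ne(2,1)] pa pb ends by auto
    have fin: "finite (verts (cycle_on n m))" by (simp add: verts_cycle_on)
    have mid: "{last us, hd vs} = {(us @ vs) ! (h - 1), (us @ vs) ! Suc (h - 1)}"
      if "length us = h" "length vs = h" for us vs :: "nat list"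
    proof -
      have "us \<noteq> []" "vs \<noteq> []" using that h16 by auto
      then show ?thesis using that h16 by (simp add: nth_append last_conv_nth hd_conv_nth)
    qed
    have a1: "addable C (path_graph (m - 1)) (cycle_on n m) k (skips m) ?c1"
    proof (rule addable_by_path[OF fin skN cN(1) dab(1) _ p1])
      show "?c1 = {(as @ bs) ! (h - 1), (as @ bs) ! Suc (h - 1)}" using mid[OF len] ends by simp
    qed (use dab m h16 h len in \<open>auto simp: verts_cycle_on\<close>)
    have a2: "addable C (path_graph (m - 1)) (cycle_on n m) k (skips m) ?c2"
    proof (rule addable_by_path[OF fin skN cN(2) dab(2) _ p2])
      show "?c2 = {(bs @ as) ! (h - 1), (bs @ as) ! Suc (h - 1)}" using mid[OF len(2,1)] ends by simp
    qed (use dab m h16 h len in \<open>auto simp: verts_cycle_on\<close>)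
    have "reachable C (path_graph (m - 1)) (cycle_on n m) k (skips m \<union> {?c1, ?c2})"
      by (rule reachable_Un[OF reach]) (use a1 a2 in auto)
    moreover have "cycle_in (skips m \<union> {?c1, ?c2}) (as @ bs)"
      using dab(1) ne p1 ends by (auto simp: cycle_in_def)
    moreover have "skips m \<union> {?c1, ?c2} \<subseteq> ?N" using skN cN by blast
    ultimately show ?thesis using that dab(3) len h by (metis length_append mult_2)
  qed
qed

text \<open>Once the added edges contain a cycle through the first \<open>m\<close> vertices, every
  further non-edge lies on a long enough path of added edges, and such paths are rainbow under every
  injective coloring. Three stages treat non-edges with two, one and no ends among these
  vertices.\<close>

lemma cycle_on_saturated:
  assumes m: "31 \<le> m" "m \<le> n" and k: "inj_on k (edges (cycle_on n m))"
  shows "weakly_rainbow_saturated C (path_graph (m - 1)) (cycle_on n m) k"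
proof -
  let ?F = "cycle_on n m"
  let ?N = "edges (complement ?F)"
  let ?H = "path_graph (m - 1)"
  have fin: "finite (verts ?F)" by (simp add: verts_cycle_on)
  have N: "e \<subseteq> {..<n} \<and> card e = 2" if "e \<in> ?N" for e using that by (auto simp: complement_def verts_cycle_on)
  have finN: "finite ?N" by (rule finite_subset[of _ "Pow {..<n}"]) (use N in auto)
  obtain S ys where S: "S \<subseteq> ?N" "reachable C ?H ?F k S" "cycle_in S ys" "set ys = {..<m}" "length ys = m"
    using reachable_hamiltonian_cycle[OF m k] by blast
  \<comment> \<open>Two ends on the cycle of added edges: the non-edge is a chord of it, and
    \<open>cycle_chord_path\<close> gives a path on \<open>m - 1\<close> vertices.\<close>
  define S1 where "S1 = S \<union> {e \<in> ?N. e \<subseteq> {..<m}}"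
  have S1: "reachable C ?H ?F k S1"
    unfolding S1_def
  proof (rule reachable_Un[OF S(2)])
    fix e assume e: "e \<in> {e \<in> ?N. e \<subseteq> {..<m}} - S"
    then obtain x y where xy: "e = {x, y}" "x \<noteq> y" using N by (metis (no_types, lifting) DiffD1 card_2_iff mem_Collect_eq)
    have in_ys: "x \<in> set ys" "y \<in> set ys" "{x, y} \<notin> S" using e xy S(4) by auto
    obtain xs i where xs: "distinct xs" "set xs \<subseteq> set ys" "Suc (length xs) = length ys"
      "path_edges xs \<subseteq> insert {x, y} S" "{x, y} = {xs ! i, xs ! Suc i}" "Suc i < length xs"
      using cycle_chord_path[OF S(3) in_ys(1,2) xy(2) in_ys(3)] by metis
    show "addable C ?H ?F k S e"
      by (rule addable_by_path[OF fin S(1), where xs = xs and i = i])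
        (use xs e xy S(4,5) m in \<open>auto simp: verts_cycle_on\<close>)
  qed (use finN in auto)
  have S1N: "S1 \<subseteq> ?N" using S(1) by (auto simp: S1_def)
  have cyc1: "cycle_in S1 ys" using S(3) by (rule cycle_in_mono) (auto simp: S1_def)
  \<comment> \<open>One end outside: the path enters the cycle through the non-edge and goes once
    around it.\<close>
  define S2 where "S2 = S1 \<union> {e \<in> ?N. e \<inter> {..<m} \<noteq> {}}"
  have S2: "reachable C ?H ?F k S2"
    unfolding S2_def
  proof (rule reachable_Un[OF S1])
    fix e assume e: "e \<in> {e \<in> ?N. e \<inter> {..<m} \<noteq> {}} - S1"
    then obtain v where v: "v \<in> e" "v < m" by auto
    have "card e = 2" using N e by blast
    then obtain w where w: "e = {v, w}" "w \<noteq> v" using v(1) by (rule card_two_other)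
    have wm: "m \<le> w" using e w v by (auto simp: S1_def)
    obtain zs where zs: "cycle_in S1 (v # zs)" "set (v # zs) = set ys" "length (v # zs) = length ys"
      using cycle_in_rotate_to[OF cyc1, of v] v(2) S(4) by (metis lessThan_iff)
    show "addable C ?H ?F k S1 e"
    proof (rule addable_by_path[OF fin S1N, where xs = "w # v # zs" and i = 0])
      show "distinct (w # v # zs)" using zs S(4) wm w by (auto simp: cycle_in_def)
      show "set (w # v # zs) \<subseteq> verts ?F" using zs(2) S(4) N[of e] e w m by (auto simp: verts_cycle_on)
      show "path_edges (w # v # zs) \<subseteq> insert e S1"
        using zs(1) w by (auto simp: cycle_in_def insert_commute)
    qed (use e w zs(3) S(5) m in auto)
  qed (use finN in auto)
  have S2N: "S2 \<subseteq> ?N" using S1N by (auto simp: S2_def)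
  \<comment> \<open>Both ends outside: the second end was joined to vertex 0 in the previous stage,
    and from there the path goes around the cycle.\<close>
  have "reachable C ?H ?F k (S2 \<union> ?N)"
  proof (rule reachable_Un[OF S2 finN])
    fix e assume e: "e \<in> ?N - S2"
    then have out: "e \<inter> {..<m} = {}" by (auto simp: S2_def)
    obtain w w' where w: "e = {w, w'}" "w \<noteq> w'" using N e by (metis DiffD1 card_2_iff)
    have wm: "m \<le> w" "m \<le> w'" "w < n" "w' < n" using out w N[of e] e by auto
    obtain zs where zs: "cycle_in S1 (0 # zs)" "set (0 # zs) = set ys" "length (0 # zs) = length ys"
      using cycle_in_rotate_to[OF cyc1, of 0] m S(4) by (metis lessThan_iff less_le_trans zero_less_numeral)
    have "{0, w'} \<in> ?N" using mem_complement_cycle_on[of 0 w' n m] wm m by simp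
    then have w0: "{w', 0} \<in> S2" using m by (auto simp: S2_def insert_commute)
    show "addable C ?H ?F k S2 e"
    proof (rule addable_by_path[OF fin S2N, where xs = "w # w' # 0 # zs" and i = 0])
      show "distinct (w # w' # 0 # zs)" using zs S(4) wm w m by (auto simp: cycle_in_def)
      show "set (w # w' # 0 # zs) \<subseteq> verts ?F" using zs(2) S(4) wm m by (auto simp: verts_cycle_on)
      show "path_edges (w # w' # 0 # zs) \<subseteq> insert e S2"
        using zs(1) w w0 by (auto simp: cycle_in_def S2_def)
    qed (use e w zs(3) S(5) m in auto)
  qed
  then show ?thesis using S2N by (simp add: Un_absorb1 weakly_rainbow_saturated_if_reachable)
qed

theorem theorem1p2:
  fixes C :: "'c set" and n l :: nat
  assumes "infinite C"
    and "n \<ge> l + 1" and "l + 1 \<ge> 31"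
  shows "rwsat C n (path_graph l) = l + 1"
  unfolding rwsat_def
proof (rule Least_equality)
  let ?F = "cycle_on n (l + 1)"
  have card: "card (edges ?F) = l + 1" by (rule card_edges_cycle_on) (use assms in simp)
  \<comment> \<open>A rainbow coloring of the cycle arises by extending the empty coloring.\<close>
  have "finite (edges ?F)" by (simp add: edges_cycle_on)
  then obtain k :: "nat set \<Rightarrow> 'c" where k: "inj_on k (edges ?F)" "k ` edges ?F \<subseteq> C"
    using extend_injective_coloring[OF _ assms(1), of "edges ?F" "{}"] by (metis empty_subsetI image_empty inj_on_empty)
  have "edge_colored_graph C ?F k"
    unfolding edge_colored_graph_def using simple_cycle_on[of "l + 1" n] assms(2,3) k(2) by auto
  moreover have "weakly_rainbow_saturated C (path_graph l) ?F k"
    using cycle_on_saturated[OF assms(3,2) k(1), of C] by simp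
  ultimately show "\<exists>(F :: nat graph) k. verts F = {..<n} \<and> edge_colored_graph C F k \<and>
      weakly_rainbow_saturated C (path_graph l) F k \<and> card (edges F) = l + 1"
    using card verts_cycle_on by blast
next
  fix m assume "\<exists>(F :: nat graph) k. verts F = {..<n} \<and> edge_colored_graph C F k \<and>
      weakly_rainbow_saturated C (path_graph l) F k \<and> card (edges F) = m"
  then show "l + 1 \<le> m" using weakly_rainbow_saturated_card_ge[OF assms(1)] assms(2,3) by fastforce
qed

end
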